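(* Let $\mathcal{X}$ be an infinite-dimensional complex reflexive Banach space. Every polynomially compact operator on $\mathcal{X}$ admits an almost-invariant half-space.
   Context: All operators are bounded and linear, and all subspaces of Banach spaces are assumed to be norm-closed. An operator $T$ is polynomially compact if there is a non-zero polynomial $p$ such that $p(T)$ is compact. A subspace $\mathcal{Y}$ of $\mathcal{X}$ is a half-space if $\dim \mathcal{Y} = \dim(\mathcal{X}/\mathcal{Y}) = \infty$. A subspace $\mathcal{Y}$ is almost-invariant for $T$ if there is a finite-dimensional subspace $\mathcal{M}$ of $\mathcal{X}$ with $T\mathcal{Y} \subseteq \mathcal{Y} + \mathcal{M}$. *)

theory Defs
  imports "HOL-Analysis.Analysis" "HOL-Computational_Algebra.Polynomial"
begin

class complex_normed_vector = real_normed_vector +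
  fixes scaleC :: "complex \<Rightarrow> 'a \<Rightarrow> 'a"  (infixr \<open>*\<^sub>C\<close> 75)
  assumes scaleC_add_right: "a *\<^sub>C (x + y) = a *\<^sub>C x + a *\<^sub>C y"
    and scaleC_add_left: "(a + b) *\<^sub>C x = a *\<^sub>C x + b *\<^sub>C x"
    and scaleC_scaleC: "a *\<^sub>C b *\<^sub>C x = (a * b) *\<^sub>C x"
    and scaleC_one: "1 *\<^sub>C x = x"
    and scaleR_scaleC: "r *\<^sub>R x = complex_of_real r *\<^sub>C x"
    and norm_scaleC: "norm (a *\<^sub>C x) = cmod a * norm x"

class complex_banach = complex_normed_vector + complete_space

instantiation complex :: complex_banach
begin

definition scaleC_complex :: "complex \<Rightarrow> complex \<Rightarrow> complex" where
  "scaleC_complex a x = a * x"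

instance
  by standard (simp_all add: scaleC_complex_def algebra_simps norm_mult scaleR_conv_of_real)

end

global_interpretation complex_vector:
  vector_space "scaleC :: complex \<Rightarrow> 'a \<Rightarrow> 'a::complex_normed_vector"
  defines csubspace = complex_vector.subspace
    and cspan = complex_vector.span
  by standard (simp_all add: scaleC_add_right scaleC_add_left scaleC_scaleC scaleC_one)

definition bounded_clinear ::
    "('a::complex_normed_vector \<Rightarrow> 'b::complex_normed_vector) \<Rightarrow> bool" where
  "bounded_clinear T \<longleftrightarrow>
     Vector_Spaces.linear (*\<^sub>C) (*\<^sub>C) T \<and> (\<exists>K. \<forall>x. norm (T x) \<le> K * norm x)"

definition dual :: "('a::complex_normed_vector \<Rightarrow> complex) set" where
  "dual = {f. bounded_clinear f}"

text \<open>Elements of the bidual are functions on all of \<^typ>\<open>'a \<Rightarrow> complex\<close>; only their values on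
  \<^term>\<open>dual\<close>, normed by \<^const>\<open>onorm\<close>, matter.\<close>

definition bidual :: "(('a::complex_normed_vector \<Rightarrow> complex) \<Rightarrow> complex) set" where
  "bidual = {\<phi>.
     (\<forall>f\<in>dual. \<forall>g\<in>dual. \<phi> (\<lambda>x. f x + g x) = \<phi> f + \<phi> g) \<and>
     (\<forall>c. \<forall>f\<in>dual. \<phi> (\<lambda>x. c * f x) = c * \<phi> f) \<and>
     (\<exists>K. \<forall>f\<in>dual. cmod (\<phi> f) \<le> K * onorm f)}"

text \<open>Surjectivity of the canonical embedding into the bidual.\<close>

definition reflexive :: "'a::complex_normed_vector itself \<Rightarrow> bool" where
  "reflexive _ \<longleftrightarrow> (\<forall>\<phi>\<in>bidual. \<exists>x::'a. \<forall>f\<in>dual. \<phi> f = f x)"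

definition closed_csubspace :: "'a::complex_normed_vector set \<Rightarrow> bool" where
  "closed_csubspace Y \<longleftrightarrow> csubspace Y \<and> closed Y"

definition finite_dim :: "'a::complex_normed_vector set \<Rightarrow> bool" where
  "finite_dim Y \<longleftrightarrow> (\<exists>B. finite B \<and> cspan B = Y)"

definition coset_rel :: "'a::complex_normed_vector set \<Rightarrow> ('a \<times> 'a) set" where
  "coset_rel Y = {(x, y). x - y \<in> Y}"

text \<open>The span in $X/Y$ of the cosets of the elements of $B$ is the image of \<^term>\<open>cspan B\<close> under
  the quotient map, so this says that $X/Y$ is spanned by finitely many cosets.\<close>

definition finite_dim_quotient :: "'a::complex_normed_vector set \<Rightarrow> bool" where
  "finite_dim_quotient Y \<longleftrightarrow>
     (\<exists>B. finite B \<and> (\<lambda>x. coset_rel Y `` {x}) ` cspan B = UNIV // coset_rel Y)"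

definition half_space :: "'a::complex_normed_vector set \<Rightarrow> bool" where
  "half_space Y \<longleftrightarrow> closed_csubspace Y \<and> \<not> finite_dim Y \<and> \<not> finite_dim_quotient Y"

definition almost_invariant ::
    "('a::complex_normed_vector \<Rightarrow> 'a) \<Rightarrow> 'a set \<Rightarrow> bool" where
  "almost_invariant T Y \<longleftrightarrow>
     closed_csubspace Y \<and>
     (\<exists>M. closed_csubspace M \<and> finite_dim M \<and> T ` Y \<subseteq> {y + m | y m. y \<in> Y \<and> m \<in> M})"

definition compact_operator ::
    "('a::complex_normed_vector \<Rightarrow> 'b::complex_normed_vector) \<Rightarrow> bool" where
  "compact_operator K \<longleftrightarrow> bounded_clinear K \<and> compact (closure (K ` cball 0 1))"

definition poly_operator ::
    "complex poly \<Rightarrow> ('a::complex_normed_vector \<Rightarrow> 'a) \<Rightarrow> 'a \<Rightarrow> 'a" where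
  "poly_operator p T x = (\<Sum>i\<le>degree p. coeff p i *\<^sub>C (T ^^ i) x)"

definition polynomially_compact :: "('a::complex_normed_vector \<Rightarrow> 'a) \<Rightarrow> bool" where
  "polynomially_compact T \<longleftrightarrow> (\<exists>p. p \<noteq> 0 \<and> compact_operator (poly_operator p T))"

end

theory Submission
  imports Defs "HOL-Computational_Algebra.Fundamental_Theorem_Algebra"
    "HOL-Complex_Analysis.Complex_Analysis"
begin

text \<open>
  If a bounded operator \<open>S\<close> has infinitely many eigenvalues \<open>\<mu> n\<close>, each of them also an eigenvalue of
  the adjoint with a bounded eigenfunctional \<open>\<phi> n\<close>, then the common kernel of the \<open>\<phi> (2 n)\<close> is an
  \<open>S\<close>-invariant half-space. So it suffices to find a finite rank perturbation \<open>S\<close> of \<open>T\<close> of this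
  kind.

  Let \<open>p(T)\<close> be compact. By Riesz theory, off the roots of \<open>p\<close> the operator \<open>\<mu> - T\<close> is either
  boundedly invertible, or \<open>\<mu>\<close> is an eigenvalue of both \<open>T\<close> and its adjoint. If the latter happens
  infinitely often, take \<open>S = T\<close>. Otherwise the spectrum is finite. If \<open>T\<close> is algebraic, it has an
  infinite-dimensional eigenspace, which either is a half-space or has finite codimension; in the
  latter case \<open>T\<close> is a finite rank perturbation of a scalar. If \<open>T\<close> is not algebraic, Baire's theorem
  yields a vector \<open>e\<close> and a functional \<open>\<phi>\<close> such that \<open>g \<mu> = \<phi> ((\<mu> - T)\<^sup>-\<^sup>1 e)\<close> is not rational,
  hence has an essential singularity. By Picard's theorem \<open>g\<close> takes some value \<open>c \<noteq> 0\<close> infinitely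
  often, and every solution of \<open>g \<mu> = c\<close> is an eigenvalue of the rank one perturbation
  \<open>T + (\<phi> / c) e\<close> and of its adjoint.
\<close>

section \<open>Bounded functionals and the Hahn-Banach theorem\<close>

lemma bounded_clinear_iff:
  "bounded_clinear T \<longleftrightarrow>
     (\<forall>x y. T (x + y) = T x + T y) \<and> (\<forall>c x. T (c *\<^sub>C x) = c *\<^sub>C T x) \<and>
     (\<exists>K. \<forall>x. norm (T x) \<le> K * norm x)"
  unfolding bounded_clinear_def Vector_Spaces.linear_iff
  by (auto simp: complex_vector.vector_space_axioms)

lemma
  assumes "bounded_clinear T"
  shows clin_add: "T (x + y) = T x + T y"
    and clin_scale: "T (c *\<^sub>C x) = c *\<^sub>C T x"
  using assms by (auto simp: bounded_clinear_iff)

lemma bounded_clinear_imp_bounded_linear: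
  assumes "bounded_clinear T"
  shows "bounded_linear T"
proof -
  obtain K where "\<And>x. norm (T x) \<le> K * norm x"
    using assms by (auto simp: bounded_clinear_iff)
  then show ?thesis
    by (intro bounded_linear_intro[where K = K])
      (auto simp: clin_add[OF assms] clin_scale[OF assms] scaleR_scaleC mult.commute)
qed

lemma
  assumes "bounded_clinear T"
  shows clin_0: "T 0 = 0" and clin_diff: "T (x - y) = T x - T y"
proof -
  interpret bounded_linear T
    by (rule bounded_clinear_imp_bounded_linear[OF assms])
  show "T 0 = 0" "T (x - y) = T x - T y"
    by (rule zero diff)+
qed

lemma clin_bound:
  assumes "bounded_clinear T"
  obtains K where "K > 0" "\<And>x. norm (T x) \<le> K * norm x"
  using bounded_linear.pos_bounded[OF bounded_clinear_imp_bounded_linear[OF assms]]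
  by (auto simp: mult.commute)

lemma clin_tendsto:
  assumes "bounded_clinear T" "(f \<longlongrightarrow> l) F"
  shows "((\<lambda>x. T (f x)) \<longlongrightarrow> T l) F"
  by (rule bounded_linear.tendsto[OF bounded_clinear_imp_bounded_linear[OF assms(1)] assms(2)])

lemma clin_continuous_on:
  assumes "bounded_clinear T"
  shows "continuous_on S T"
  by (rule linear_continuous_on[OF bounded_clinear_imp_bounded_linear[OF assms]])

lemma bounded_clinearI:
  assumes "\<And>x y. T (x + y) = T x + T y" "\<And>c x. T (c *\<^sub>C x) = c *\<^sub>C T x"
    and "\<And>x. norm (T x) \<le> K * norm x"
  shows "bounded_clinear T"
  using assms by (auto simp: bounded_clinear_iff)

lemma bounded_clinear_scaleC: "bounded_clinear (\<lambda>x. c *\<^sub>C x)"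
  by (rule bounded_clinearI[where K = "cmod c"])
    (auto simp: scaleC_add_right scaleC_scaleC norm_scaleC mult.commute)

lemma bounded_clinear_id: "bounded_clinear (\<lambda>x. x)"
  by (rule bounded_clinearI[where K = 1]) auto

lemma bounded_clinear_zero: "bounded_clinear (\<lambda>x. 0)"
  by (rule bounded_clinearI[where K = 0]) auto

lemma bounded_clinear_add:
  assumes "bounded_clinear S" "bounded_clinear T"
  shows "bounded_clinear (\<lambda>x. S x + T x)"
proof -
  obtain K L where "\<And>x. norm (S x) \<le> K * norm x" "\<And>x. norm (T x) \<le> L * norm x"
    using assms by (metis bounded_clinear_iff)
  then have "norm (S x + T x) \<le> (K + L) * norm x" for x
    by (metis add_mono distrib_right norm_triangle_mono)
  then show ?thesis
    by (intro bounded_clinearI)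
      (auto simp: clin_add[OF assms(1)] clin_add[OF assms(2)] clin_scale[OF assms(1)]
        clin_scale[OF assms(2)] scaleC_add_right)
qed

lemma bounded_clinear_compose:
  assumes "bounded_clinear S" "bounded_clinear T"
  shows "bounded_clinear (\<lambda>x. S (T x))"
proof -
  obtain K where K: "K > 0" "\<And>x. norm (S x) \<le> K * norm x"
    using clin_bound[OF assms(1)] by blast
  obtain L where L: "L > 0" "\<And>x. norm (T x) \<le> L * norm x"
    using clin_bound[OF assms(2)] by blast
  have "norm (S (T x)) \<le> K * (L * norm x)" for x
    using K(2)[of "T x"] mult_left_mono[OF L(2)[of x], of K] K(1) by linarith
  then show ?thesis
    by (intro bounded_clinearI[where K = "K * L"])
      (auto simp: mult.assoc clin_add[OF assms(1)] clin_add[OF assms(2)] clin_scale[OF assms(1)]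
        clin_scale[OF assms(2)])
qed

lemma bounded_clinear_diff:
  assumes "bounded_clinear S" "bounded_clinear T"
  shows "bounded_clinear (\<lambda>x. S x - T x)"
  using bounded_clinear_add[OF assms(1)
      bounded_clinear_compose[OF bounded_clinear_scaleC[of "-1"] assms(2)]]
  by simp

lemma bounded_clinear_rank_one:
  assumes "bounded_clinear f"
  shows "bounded_clinear (\<lambda>x. f x *\<^sub>C b)"
proof -
  obtain K where K: "\<And>x. norm (f x) \<le> K * norm x"
    using clin_bound[OF assms] by blast
  have "norm (f x *\<^sub>C b) \<le> (K * norm b) * norm x" for x
    using mult_right_mono[OF K[of x] norm_ge_zero[of b]] by (simp add: norm_scaleC algebra_simps)
  then show ?thesis
    by (intro bounded_clinearI)
      (auto simp: clin_add[OF assms] clin_scale[OF assms] scaleC_add_left scaleC_scaleC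
        scaleC_complex_def)
qed

lemma closed_csubspace_ker:
  assumes "bounded_clinear T"
  shows "closed_csubspace {x. T x = 0}"
  unfolding closed_csubspace_def
proof
  show "csubspace {x. T x = 0}"
    by (auto simp: complex_vector.subspace_def clin_0[OF assms] clin_add[OF assms]
        clin_scale[OF assms])
  have "closed (T -` {0})"
    using clin_continuous_on[OF assms] by (intro closed_vimage) auto
  then show "closed {x. T x = 0}"
    by (simp add: vimage_def)
qed

section \<open>The distance to a subspace as a seminorm\<close>

lemma csubspace_imp_subspace: "csubspace W \<Longrightarrow> subspace W"
  by (auto simp: complex_vector.subspace_def real_vector.subspace_def scaleR_scaleC)

lemma infdist_less_obtain:
  assumes "csubspace W" "infdist x W < d"
  obtains w where "w \<in> W" "norm (x - w) < d"
proof -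
  have ne: "W \<noteq> {}"
    using assms(1) by (auto simp: complex_vector.subspace_def)
  have "\<exists>w\<in>W. dist x w < d"
    using assms(2) ne cInf_lessD[of "dist x ` W" d] by (auto simp: infdist_def)
  then show thesis
    using that by (auto simp: dist_norm)
qed

text \<open>The distance to \<open>W\<close> is the quotient seminorm modulo \<open>W\<close>.
  Subadditivity here and homogeneity in the next lemma qualify it as the dominating seminorm for the
  Hahn-Banach theorem.\<close>

lemma infdist_subspace_add:
  assumes "csubspace W"
  shows "infdist (x + y) W \<le> infdist x W + infdist y W"
proof (rule field_le_epsilon)
  fix e :: real
  assume "0 < e"
  then obtain w z where "w \<in> W" "norm (x - w) < infdist x W + e/2"
    "z \<in> W" "norm (y - z) < infdist y W + e/2"
    using infdist_less_obtain[OF assms, of x "infdist x W + e/2"]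
      infdist_less_obtain[OF assms, of y "infdist y W + e/2"]
    by (metis half_gt_zero less_add_same_cancel1)
  moreover have "infdist (x + y) W \<le> norm (x + y - (w + z))"
    using assms \<open>w \<in> W\<close> \<open>z \<in> W\<close> infdist_le[of "w + z" W "x + y"]
    by (simp add: complex_vector.subspace_add dist_norm)
  moreover have "norm (x + y - (w + z)) \<le> norm (x - w) + norm (y - z)"
    by (metis add_diff_add norm_triangle_ineq)
  ultimately show "infdist (x + y) W \<le> infdist x W + infdist y W + e"
    by linarith
qed

lemma infdist_subspace_scaleC:
  assumes "csubspace W"
  shows "infdist (c *\<^sub>C x) W = cmod c * infdist x W"
proof -
  have 0: "0 \<in> W"
    using assms by (rule complex_vector.subspace_0)
  have le: "infdist (c *\<^sub>C x) W \<le> cmod c * infdist x W" for c x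
  proof (cases "c = 0")
    case True
    then show ?thesis
      using 0 by simp
  next
    case False
    show ?thesis
    proof (rule field_le_epsilon)
      fix e :: real
      assume "0 < e"
      then have "infdist x W < infdist x W + e / cmod c"
        using False by simp
      then obtain w where w: "w \<in> W" "norm (x - w) < infdist x W + e / cmod c"
        using infdist_less_obtain[OF assms] by metis
      have "infdist (c *\<^sub>C x) W \<le> norm (c *\<^sub>C x - c *\<^sub>C w)"
        using infdist_le[of "c *\<^sub>C w" W "c *\<^sub>C x"] assms w
        by (simp add: complex_vector.subspace_scale dist_norm)
      also have "\<dots> = cmod c * norm (x - w)"
        by (metis complex_vector.scale_right_diff_distrib norm_scaleC)
      also have "\<dots> \<le> cmod c * (infdist x W + e / cmod c)"
        using w(2) by (intro mult_left_mono) auto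
      also have "\<dots> = cmod c * infdist x W + e"
        using False by (simp add: field_simps)
      finally show "infdist (c *\<^sub>C x) W \<le> cmod c * infdist x W + e" .
    qed
  qed
  show ?thesis
  proof (cases "c = 0")
    case True
    then show ?thesis
      using 0 by simp
  next
    case False
    \<comment> \<open>The reverse inequality is \<open>le\<close> for the vector
      \<open>c *\<^sub>C x\<close> and the factor \<open>inverse c\<close>.\<close>
    have "infdist x W = infdist (inverse c *\<^sub>C c *\<^sub>C x) W"
      using False by (simp add: scaleC_scaleC scaleC_one)
    also have "\<dots> \<le> cmod (inverse c) * infdist (c *\<^sub>C x) W"
      by (rule le)
    finally have "cmod c * infdist x W \<le> infdist (c *\<^sub>C x) W"
      using False by (simp add: norm_inverse norm_divide field_simps)
    then show ?thesis
      using le[of c x] by linarith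
  qed
qed

text \<open>Partial linear functionals are represented by their graphs, which are the subspaces of the
  product with \<^typ>\<open>real\<close>. Single-valuedness is automatic, being a consequence of the
  bound by the seminorm at \<open>0\<close>.\<close>

lemma hahn_banach_seminorm:
  fixes p :: "'a::real_vector \<Rightarrow> real"
  assumes add: "\<And>x y. p (x + y) \<le> p x + p y" and scale: "\<And>r x. p (r *\<^sub>R x) = \<bar>r\<bar> * p x"
  obtains u where "linear u" "u v = p v" "\<And>x. u x \<le> p x"
proof -
  define A where "A = {G. subspace G \<and> (v, p v) \<in> G \<and> (\<forall>(x, a) \<in> G. a \<le> p x)}"
  have p0: "p 0 = 0"
    using scale[of 0] by simp
  have p_nonneg: "p x \<ge> 0" for x
    using add[of x "- x"] scale[of "-1" x] p0 by simp
  have "span {(v, p v)} \<in> A"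
    using p_nonneg[of v] real_vector.subspace_span[of "{(v, p v)}"]
      span_base[of "(v, p v)" "{(v, p v)}"]
    unfolding A_def by (auto simp: span_singleton scale intro!: mult_right_mono)
  then have "A \<noteq> {}"
    by auto
  have "\<exists>M\<in>A. \<forall>X\<in>A. M \<subseteq> X \<longrightarrow> X = M"
  proof (rule subset_Zorn_nonempty[OF \<open>A \<noteq> {}\<close>])
    fix C
    assume C: "C \<noteq> {}" "subset.chain A C"
    then have CA: "C \<subseteq> A" and lin: "\<And>X Y. X \<in> C \<Longrightarrow> Y \<in> C \<Longrightarrow> X \<subseteq> Y \<or> Y \<subseteq> X"
      by (auto simp: subset_chain_def)
    have "subspace (\<Union>C)"
    proof (rule real_vector.subspaceI)
      show "0 \<in> \<Union>C"
        using C(1) CA by (auto simp: A_def dest: real_vector.subspace_0)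
      show "x + y \<in> \<Union>C" if xy: "x \<in> \<Union>C" "y \<in> \<Union>C" for x y
      proof -
        obtain X Y where "X \<in> C" "x \<in> X" "Y \<in> C" "y \<in> Y"
          using xy by blast
        then obtain Z where "Z \<in> C" "x \<in> Z" "y \<in> Z"
          using lin[of X Y] by blast
        then show ?thesis
          using CA by (auto simp: A_def intro!: bexI[of _ Z] real_vector.subspace_add)
      qed
      show "r *\<^sub>R x \<in> \<Union>C" if "x \<in> \<Union>C" for r x
        using that CA by (auto simp: A_def intro: real_vector.subspace_scale)
    qed
    then show "\<Union>C \<in> A"
      using C(1) CA by (fastforce simp: A_def)
  qed
  then obtain G where G: "G \<in> A" and max: "\<And>X. X \<in> A \<Longrightarrow> G \<subseteq> X \<Longrightarrow> X = G"
    by blast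
  then have subG: "subspace G" and vG: "(v, p v) \<in> G" and bound: "\<And>x a. (x, a) \<in> G \<Longrightarrow> a \<le> p x"
    by (auto simp: A_def)
  have single: "a = b" if "(x, a) \<in> G" "(x, b) \<in> G" for x a b
  proof -
    have "(0, a - b) \<in> G" "(0, b - a) \<in> G"
      using real_vector.subspace_diff[OF subG that]
        real_vector.subspace_diff[OF subG that(2) that(1)] by simp_all
    then show ?thesis
      using bound[of 0 "a - b"] bound[of 0 "b - a"] p0 by linarith
  qed
  have total: "\<exists>a. (x, a) \<in> G" for x
  proof (rule ccontr)
    assume nx: "\<nexists>a. (x, a) \<in> G"
    \<comment> \<open>A value \<open>s\<close> at \<open>x\<close> keeps the extension below
      \<open>p\<close> exactly if it lies above all \<open>a - p (y - x)\<close> and below all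
      \<open>p (z + x) - b\<close>. By \<open>ab\<close> the first family lies below the second, so
      its supremum is a valid choice.\<close>
    define L where "L = (\<lambda>(y, a). a - p (y - x)) ` G"
    define s where "s = Sup L"
    have ab: "a - p (y - x) \<le> p (z + x) - b" if "(y, a) \<in> G" "(z, b) \<in> G" for y a z b
    proof -
      have "(y + z, a + b) \<in> G"
        using real_vector.subspace_add[OF subG that] by simp
      then have "a + b \<le> p ((y - x) + (z + x))"
        using bound by fastforce
      then show ?thesis
        using add[of "y - x" "z + x"] by linarith
    qed
    have L: "L \<noteq> {}" "bdd_above L"
      using vG ab[OF _ vG]
      by (auto simp: L_def intro!: bdd_aboveI[where M = "p (v + x) - p v"])
    have lower: "a - p (y - x) \<le> s" if "(y, a) \<in> G" for y a
      unfolding s_def using L(2) that by (intro cSup_upper) (auto simp: L_def)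
    have upper: "s \<le> p (z + x) - b" if "(z, b) \<in> G" for z b
      unfolding s_def using L(1) ab[OF _ that] by (intro cSup_least) (auto simp: L_def)
    define G' where "G' = {g + h | g h. g \<in> G \<and> h \<in> span {(x, s)}}"
    have "subspace G'"
      unfolding G'_def by (rule real_vector.subspace_sums[OF subG]) simp
    moreover have GG': "G \<subseteq> G'"
    proof
      fix g
      assume "g \<in> G"
      then show "g \<in> G'"
        unfolding G'_def by (intro CollectI exI[of _ g] exI[of _ 0]) (auto simp: span_zero)
    qed
    moreover have "b \<le> p z" if zb: "(z, b) \<in> G'" for z b
    proof -
      obtain y a t where ya: "(y, a) \<in> G" and z: "z = y + t *\<^sub>R x" "b = a + t * s"
        using zb by (auto simp: G'_def span_singleton)
      \<comment> \<open>Dividing by the absolute value of \<open>t\<close> reduces to the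
        coefficients 1 and -1 of \<open>x\<close>, which are the cases \<open>upper\<close> and
        \<open>lower\<close>.\<close>
      consider "t = 0" | "t > 0" | "t < 0"
        by linarith
      then show ?thesis
      proof cases
        case 1
        then show ?thesis
          using bound[OF ya] z by simp
      next
        case 2
        have "(inverse t *\<^sub>R y, inverse t * a) \<in> G"
          using real_vector.subspace_scale[OF subG ya, of "inverse t"] by simp
        then have "s \<le> p (inverse t *\<^sub>R y + x) - inverse t * a"
          by (rule upper)
        then have "t * s \<le> t * (p (inverse t *\<^sub>R y + x) - inverse t * a)"
          using 2 by simp
        also have "\<dots> = p (t *\<^sub>R (inverse t *\<^sub>R y + x)) - a"
          using 2 by (simp only: scale) (simp add: algebra_simps)
        also have "t *\<^sub>R (inverse t *\<^sub>R y + x) = z"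
          using 2 z by (simp add: algebra_simps)
        finally show ?thesis
          using z by simp
      next
        case 3
        define r where "r = - t"
        have r: "r > 0"
          using 3 by (simp add: r_def)
        have "(inverse r *\<^sub>R y, inverse r * a) \<in> G"
          using real_vector.subspace_scale[OF subG ya, of "inverse r"] by simp
        then have "inverse r * a - p (inverse r *\<^sub>R y - x) \<le> s"
          by (rule lower)
        then have "r * (inverse r * a - p (inverse r *\<^sub>R y - x)) \<le> r * s"
          using r by simp
        moreover have "r * (inverse r * a - p (inverse r *\<^sub>R y - x)) =
            a - p (r *\<^sub>R (inverse r *\<^sub>R y - x))"
          using r by (simp only: scale) (simp add: algebra_simps)
        moreover have "r *\<^sub>R (inverse r *\<^sub>R y - x) = z"
          using r z by (simp add: algebra_simps r_def)
        ultimately show ?thesis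
          using z by (simp add: r_def)
      qed
    qed
    ultimately have "G' \<in> A"
      using vG by (auto simp: A_def)
    then have "G' = G"
      using GG' max by blast
    moreover have "(x, s) \<in> G'"
      unfolding G'_def using real_vector.subspace_0[OF subG]
      by (intro CollectI exI[of _ 0] exI[of _ "(x, s)"]) (auto simp: span_base)
    ultimately show False
      using nx by blast
  qed
  define u where "u x = (THE a. (x, a) \<in> G)" for x
  have uG: "(x, u x) \<in> G" for x
    unfolding u_def using total single by (metis theI')
  show thesis
  proof
    show "linear u"
    proof (rule linearI)
      show "u (x + y) = u x + u y" for x y
        using single[OF uG, of "x + y"] real_vector.subspace_add[OF subG uG[of x] uG[of y]] by simp
      show "u (r *\<^sub>R x) = r *\<^sub>R u x" for r x
        using single[OF uG, of "r *\<^sub>R x"] real_vector.subspace_scale[OF subG uG[of x], of r] by simp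
    qed
    show "u v = p v"
      using single[OF uG vG] .
    show "u x \<le> p x" for x
      using bound[OF uG] .
  qed
qed

text \<open>Hahn-Banach for the distance to \<open>W\<close> gives a real functional that is bounded
  in absolute value by this distance. So it vanishes on \<open>W\<close>, and its value at
  \<open>v\<close> is the distance of \<open>v\<close>, which is positive because \<open>W\<close>
  is closed.\<close>

lemma dual_vanishing_on_subspace:
  fixes W :: "'a::complex_normed_vector set"
  assumes "closed_csubspace W" "v \<notin> W"
  obtains f where "f \<in> dual" "\<And>w. w \<in> W \<Longrightarrow> f w = 0" "f v = 1"
proof -
  have sub: "csubspace W" and "closed W"
    using assms by (auto simp: closed_csubspace_def)
  then have "W \<noteq> {}"
    using complex_vector.subspace_0 by blast
  define p where "p x = infdist x W" for x
  obtain u where u: "linear u" "u v = p v" and le: "\<And>x. u x \<le> p x"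
  proof (rule hahn_banach_seminorm[of p v])
    show "p (x + y) \<le> p x + p y" for x y
      unfolding p_def by (rule infdist_subspace_add[OF sub])
    show "p (r *\<^sub>R x) = \<bar>r\<bar> * p x" for r x
      unfolding p_def by (simp add: scaleR_scaleC infdist_subspace_scaleC[OF sub])
  qed blast
  have pv: "p v > 0"
    using assms(2) \<open>closed W\<close> \<open>W \<noteq> {}\<close>
    by (metis p_def in_closed_iff_infdist_zero infdist_nonneg less_eq_real_def)
  have p_norm: "p x \<le> norm x" for x
    using infdist_le[OF complex_vector.subspace_0[OF sub], of x] by (simp add: p_def)
  have abs_u: "\<bar>u x\<bar> \<le> p x" for x
    using le[of x] le[of "- x"] infdist_subspace_scaleC[OF sub, of "-1" x]
    by (simp add: p_def linear_neg[OF u(1)] abs_le_iff)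
  \<comment> \<open>The complex linear functional with real part \<open>u\<close>, namely u(x) - i
    u(i x).\<close>
  define g where "g x = Complex (u x) (- u (\<i> *\<^sub>C x))" for x
  have g_i: "g (\<i> *\<^sub>C x) = \<i> * g x" for x
    using linear_neg[OF u(1)] by (simp add: g_def complex_eq_iff scaleC_scaleC scaleC_one)
  have g_add: "g (x + y) = g x + g y" for x y
    by (simp add: g_def complex_eq_iff linear_add[OF u(1)] scaleC_add_right)
  have g_real: "g (complex_of_real r *\<^sub>C x) = complex_of_real r * g x" for r x
  proof -
    have "\<i> *\<^sub>C complex_of_real r *\<^sub>C x = r *\<^sub>R \<i> *\<^sub>C x"
      by (simp add: scaleR_scaleC scaleC_scaleC mult.commute)
    then show ?thesis
      using linear_scale[OF u(1)]
      by (simp add: g_def complex_eq_iff flip: scaleR_scaleC)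
  qed
  have g_scale: "g (c *\<^sub>C x) = c * g x" for c x
  proof -
    have "c *\<^sub>C x = complex_of_real (Re c) *\<^sub>C x + \<i> *\<^sub>C complex_of_real (Im c) *\<^sub>C x"
      by (metis complex_eq scaleC_add_left scaleC_scaleC)
    then have "g (c *\<^sub>C x) = (complex_of_real (Re c) + \<i> * complex_of_real (Im c)) * g x"
      by (simp only: g_add g_i g_real) (simp add: algebra_simps)
    then show ?thesis
      by (simp add: complex_eq[symmetric])
  qed
  have "norm (g x) \<le> 2 * norm x" for x
  proof -
    have "norm (g x) \<le> \<bar>u x\<bar> + \<bar>u (\<i> *\<^sub>C x)\<bar>"
      using cmod_le[of "g x"] by (simp add: g_def)
    also have "\<dots> \<le> norm x + norm (\<i> *\<^sub>C x)"
      by (meson abs_u add_mono order_trans p_norm)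
    finally show ?thesis
      by (simp add: norm_scaleC)
  qed
  then have g_dual: "bounded_clinear g"
    by (intro bounded_clinearI) (auto simp: g_add g_scale scaleC_complex_def)
  have gv: "g v \<noteq> 0"
    using pv u(2) by (simp add: g_def complex_eq_iff)
  have g_W: "g w = 0" if "w \<in> W" for w
    using abs_u[of w] abs_u[of "\<i> *\<^sub>C w"] that complex_vector.subspace_scale[OF sub that, of \<i>]
    by (simp add: g_def p_def complex_eq_iff)
  show thesis
  proof
    show "(\<lambda>x. inverse (g v) * g x) \<in> dual"
      using bounded_clinear_compose[OF bounded_clinear_scaleC[of "inverse (g v)"] g_dual]
      by (simp add: dual_def scaleC_complex_def)
  qed (use gv g_W in auto)
qed

lemma closed_csubspace_zero: "closed_csubspace {0}"
  by (auto simp: closed_csubspace_def)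

lemma dual_nonzero_at:
  fixes v :: "'a::complex_normed_vector"
  assumes "v \<noteq> 0"
  obtains f where "f \<in> dual" "f v = 1"
  using dual_vanishing_on_subspace[OF closed_csubspace_zero, of v] assms by blast

text \<open>For a new vector \<open>b\<close>, a functional that vanishes on \<open>cspan B\<close>
  and is 1 at \<open>b\<close> reads off the coefficient of \<open>b\<close>. The larger span is
  therefore the preimage of the closed set \<open>cspan B\<close> under a continuous map.\<close>

lemma closed_csubspace_cspan_finite:
  fixes B :: "'a::complex_normed_vector set"
  assumes "finite B"
  shows "closed_csubspace (cspan B)"
  using assms
proof (induction B)
  case empty
  then show ?case
    by (simp add: closed_csubspace_zero)
next
  case (insert b B)
  show ?case
  proof (cases "b \<in> cspan B")
    case True
    then show ?thesis
      using insert.IH by (simp add: complex_vector.span_redundant)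
  next
    case False
    obtain f where f: "f \<in> dual" "\<And>w. w \<in> cspan B \<Longrightarrow> f w = 0" "f b = 1"
      using dual_vanishing_on_subspace[OF insert.IH False] by blast
    have fb: "bounded_clinear f"
      using f(1) by (simp add: dual_def)
    have eq: "cspan (insert b B) = {x. x - f x *\<^sub>C b \<in> cspan B}"
    proof (intro set_eqI iffI CollectI)
      fix x
      assume "x \<in> cspan (insert b B)"
      then obtain k where k: "x - k *\<^sub>C b \<in> cspan B"
        by (auto simp: complex_vector.span_insert)
      then have "f (x - k *\<^sub>C b) = 0"
        by (rule f(2))
      then have "f x = k"
        by (simp add: clin_diff[OF fb] clin_scale[OF fb] f(3) scaleC_complex_def)
      then show "x - f x *\<^sub>C b \<in> cspan B"
        using k by simp
    qed (auto simp: complex_vector.span_insert)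
    have "continuous_on UNIV (\<lambda>x. x - f x *\<^sub>C b)"
      by (intro clin_continuous_on bounded_clinear_diff bounded_clinear_id
          bounded_clinear_rank_one fb)
    then have "closed ((\<lambda>x. x - f x *\<^sub>C b) -` cspan B)"
      using insert.IH by (intro closed_vimage) (auto simp: closed_csubspace_def)
    then show ?thesis
      by (simp add: closed_csubspace_def eq vimage_def)
        (metis eq complex_vector.subspace_span)
  qed
qed

section \<open>Half-spaces from eigenvectors\<close>

lemma clin_sum:
  assumes "bounded_clinear T"
  shows "T (\<Sum>i\<in>F. f i) = (\<Sum>i\<in>F. T (f i))"
  by (rule linear_sum[OF bounded_linear.linear[OF bounded_clinear_imp_bounded_linear[OF assms]]])

lemma bounded_clinear_sum:
  assumes "finite F" "\<And>i. i \<in> F \<Longrightarrow> bounded_clinear (f i)"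
  shows "bounded_clinear (\<lambda>x. \<Sum>i\<in>F. f i x)"
  using assms by (induction F) (auto intro: bounded_clinear_zero bounded_clinear_add)

lemma finite_dim_cspan: "finite B \<Longrightarrow> finite_dim (cspan B)"
  by (auto simp: finite_dim_def)

lemma finite_dim_subspace:
  assumes "finite_dim W" "csubspace V" "V \<subseteq> W"
  shows "finite_dim V"
proof -
  obtain B where B: "finite B" "cspan B = W"
    using assms(1) by (auto simp: finite_dim_def)
  obtain C where C: "C \<subseteq> V" "\<not> complex_vector.dependent C" "V \<subseteq> cspan C"
    using complex_vector.basis_exists[of V] by metis
  have "finite C"
    using complex_vector.independent_span_bound[OF B(1) C(2)] B(2) C(1) assms(3) by auto
  moreover have "cspan C = V"
    using C(1,3) complex_vector.span_minimal[OF C(1) assms(2)] by auto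
  ultimately show ?thesis
    by (auto simp: finite_dim_def)
qed

lemma finite_dim_quotientE:
  assumes "finite_dim_quotient Y" "csubspace Y"
  obtains B where "finite B" "\<And>x. \<exists>b\<in>cspan B. x - b \<in> Y"
proof -
  obtain B where B: "finite B"
    "(\<lambda>x. coset_rel Y `` {x}) ` cspan B = UNIV // coset_rel Y"
    using assms(1) by (auto simp: finite_dim_quotient_def)
  have "\<exists>b\<in>cspan B. x - b \<in> Y" for x
  proof -
    have "coset_rel Y `` {x} \<in> (\<lambda>x. coset_rel Y `` {x}) ` cspan B"
      unfolding B(2) by (rule quotientI) simp
    then obtain b where b: "b \<in> cspan B" "coset_rel Y `` {b} = coset_rel Y `` {x}"
      by auto
    have "b \<in> coset_rel Y `` {b}"
      using complex_vector.subspace_0[OF assms(2)] by (simp add: coset_rel_def)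
    then have "b \<in> coset_rel Y `` {x}"
      unfolding b(2) .
    then show ?thesis
      using b(1) by (auto simp: coset_rel_def)
  qed
  then show thesis
    using B(1) that by blast
qed

text \<open>Independence as an indexed family includes injectivity, so the range would be an
  infinite independent set inside a finitely generated span.\<close>

lemma not_finite_dim_independent_sequence:
  fixes v :: "nat \<Rightarrow> 'a::complex_normed_vector"
  assumes indep: "\<And>F c. finite F \<Longrightarrow> (\<Sum>i\<in>F. c i *\<^sub>C v i) = 0 \<Longrightarrow> \<forall>i\<in>F. c i = 0"
    and "range v \<subseteq> Y"
  shows "\<not> finite_dim Y"
proof
  assume "finite_dim Y"
  then obtain B where B: "finite B" "cspan B = Y"
    by (auto simp: finite_dim_def)
  have inj: "inj v"
  proof (rule injI, rule ccontr)
    fix i j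
    assume "v i = v j" "i \<noteq> j"
    then have "(\<Sum>k\<in>{i, j}. (if k = i then 1 else - 1) *\<^sub>C v k) = 0"
      by (simp add: scaleC_one)
    from indep[OF _ this] show False
      by auto
  qed
  have "\<not> complex_vector.dependent (range v)"
  proof
    assume "complex_vector.dependent (range v)"
    then obtain S u where S: "finite S" "S \<subseteq> range v" "(\<Sum>x\<in>S. u x *\<^sub>C x) = 0" "\<exists>x\<in>S. u x \<noteq> 0"
      unfolding complex_vector.dependent_explicit by blast
    obtain F where F: "finite F" "S = v ` F"
      using S(1,2) by (meson finite_subset_image)
    have "(\<Sum>i\<in>F. u (v i) *\<^sub>C v i) = 0"
      using S(3) inj by (simp add: F(2) sum.reindex inj_on_subset)
    then show False
      using indep[OF F(1), of "\<lambda>i. u (v i)"] S(4) F(2) by blast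
  qed
  then have "finite (range v)"
    using complex_vector.independent_span_bound[OF B(1)] B(2) assms(2) by blast
  then show False
    using inj finite_imageD by blast
qed

text \<open>The matrix of the values \<open>\<phi> k (w n)\<close> is triangular with nonzero
  diagonal. If \<open>k\<close> is the least index with \<open>c k\<close> nonzero,
  \<open>\<phi> k\<close> maps the sum to \<open>c k * \<phi> k (w k)\<close>: smaller indices have
  zero coefficients, larger ones are annihilated.\<close>

lemma triangular_independent:
  fixes w :: "nat \<Rightarrow> 'a::complex_normed_vector"
  assumes "\<And>n. \<phi> n \<in> dual" "\<And>n. \<phi> n (w n) \<noteq> 0" "\<And>k n. k < n \<Longrightarrow> \<phi> k (w n) = 0"
    and "finite F" "(\<Sum>i\<in>F. c i *\<^sub>C w i) = 0"
  shows "\<forall>i\<in>F. c i = 0"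
proof (rule ccontr)
  assume "\<not> (\<forall>i\<in>F. c i = 0)"
  then have ex: "\<exists>k. k \<in> F \<and> c k \<noteq> 0"
    by blast
  define k where "k = (LEAST k. k \<in> F \<and> c k \<noteq> 0)"
  have k: "k \<in> F" "c k \<noteq> 0"
    using LeastI_ex[OF ex] by (simp_all add: k_def)
  have "c i = 0" if "i \<in> F" "i < k" for i
    using not_less_Least[of i "\<lambda>k. k \<in> F \<and> c k \<noteq> 0"] that by (simp add: k_def)
  then have other: "c i * \<phi> k (w i) = 0" if "i \<in> F - {k}" for i
    using that assms(3)[of k i] by (cases "i < k") auto
  have \<phi>: "bounded_clinear (\<phi> k)"
    using assms(1) by (simp add: dual_def)
  have "0 = \<phi> k (\<Sum>i\<in>F. c i *\<^sub>C w i)"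
    using assms(5) clin_0[OF \<phi>] by simp
  also have "\<dots> = (\<Sum>i\<in>F. c i * \<phi> k (w i))"
    by (simp add: clin_sum[OF \<phi>] clin_scale[OF \<phi>] scaleC_complex_def)
  also have "\<dots> = c k * \<phi> k (w k)"
    using assms(4) k(1) other by (simp add: sum.remove sum.neutral)
  finally show False
    using k(2) assms(2) by simp
qed

text \<open>Representatives of the \<open>w n\<close> modulo \<open>Y\<close> have the same values
  under all \<open>\<phi> k\<close>, hence are independent as well. They cannot all lie in one
  finite-dimensional complement.\<close>

lemma not_finite_dim_quotient_triangular:
  fixes w :: "nat \<Rightarrow> 'a::complex_normed_vector"
  assumes "\<And>n. \<phi> n \<in> dual" "\<And>n. \<phi> n (w n) \<noteq> 0" "\<And>k n. k < n \<Longrightarrow> \<phi> k (w n) = 0"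
    and "csubspace Y" "\<And>n y. y \<in> Y \<Longrightarrow> \<phi> n y = 0"
  shows "\<not> finite_dim_quotient Y"
proof
  assume "finite_dim_quotient Y"
  then obtain B where B: "finite B" "\<And>x. \<exists>b\<in>cspan B. x - b \<in> Y"
    using assms(4) by (rule finite_dim_quotientE) blast
  then have "\<forall>n. \<exists>b. b \<in> cspan B \<and> w n - b \<in> Y"
    by blast
  then obtain b where b: "\<And>n. b n \<in> cspan B" "\<And>n. w n - b n \<in> Y"
    by metis
  have eq: "\<phi> k (b n) = \<phi> k (w n)" for k n
    using assms(5)[OF b(2), of k n] assms(1)[of k] clin_diff[of "\<phi> k" "w n" "b n"]
    by (simp add: dual_def)
  have "\<not> finite_dim (cspan B)"
  proof (rule not_finite_dim_independent_sequence)
    show "\<forall>i\<in>F. c i = 0" if "finite F" "(\<Sum>i\<in>F. c i *\<^sub>C b i) = 0" for F c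
      by (rule triangular_independent[where \<phi> = \<phi>, OF assms(1) _ _ that]) (auto simp: eq assms(2,3))
  qed (use b(1) in auto)
  then show False
    using finite_dim_cspan[OF B(1)] by blast
qed

lemma closed_csubspace_common_kernel:
  fixes \<phi> :: "nat \<Rightarrow> 'a::complex_normed_vector \<Rightarrow> complex"
  assumes "\<And>n. \<phi> n \<in> dual"
  shows "closed_csubspace {x. \<forall>n. \<phi> n x = 0}"
proof -
  have eq: "{x. \<forall>n. \<phi> n x = 0} = (\<Inter>n. {x. \<phi> n x = 0})"
    by auto
  have "closed_csubspace {x. \<phi> n x = 0}" for n
    using assms by (intro closed_csubspace_ker) (simp add: dual_def)
  then show ?thesis
    unfolding eq closed_csubspace_def
    by (auto intro!: complex_vector.subspace_Inter)
qed

text \<open>Applying \<open>S\<close> minus the eigenvalue \<open>\<mu> n\<close> removes the term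
  of \<open>v n\<close> and multiplies every other coefficient by the nonzero number
  \<open>\<mu> i - \<mu> n\<close>, which gives the induction step.\<close>

lemma eigenvectors_independent:
  fixes v :: "nat \<Rightarrow> 'a::complex_normed_vector"
  assumes S: "bounded_clinear S" and "inj \<mu>"
    and v: "\<And>n. S (v n) = \<mu> n *\<^sub>C v n" "\<And>n. v n \<noteq> 0"
    and "finite F" "(\<Sum>i\<in>F. c i *\<^sub>C v i) = 0"
  shows "\<forall>i\<in>F. c i = 0"
  using assms(5,6)
proof (induction F arbitrary: c)
  case (insert n F)
  have sum0: "c n *\<^sub>C v n + (\<Sum>i\<in>F. c i *\<^sub>C v i) = 0"
    using insert by simp
  have "0 = S (c n *\<^sub>C v n + (\<Sum>i\<in>F. c i *\<^sub>C v i)) -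
      \<mu> n *\<^sub>C (c n *\<^sub>C v n + (\<Sum>i\<in>F. c i *\<^sub>C v i))"
    unfolding sum0 by (simp add: clin_0[OF S])
  also have "\<dots> = (\<Sum>i\<in>F. S (c i *\<^sub>C v i) - \<mu> n *\<^sub>C c i *\<^sub>C v i)"
    by (simp add: clin_add[OF S] clin_sum[OF S] clin_scale[OF S] v(1) scaleC_scaleC scaleC_add_right
        complex_vector.scale_sum_right sum_subtractf mult.commute)
  also have "\<dots> = (\<Sum>i\<in>F. (c i * (\<mu> i - \<mu> n)) *\<^sub>C v i)"
    by (intro sum.cong)
      (auto simp: clin_scale[OF S] v(1) scaleC_scaleC algebra_simps
        complex_vector.scale_left_diff_distrib)
  finally have "\<forall>i\<in>F. c i * (\<mu> i - \<mu> n) = 0"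
    by (intro insert.IH) (rule sym)
  moreover have "\<mu> i \<noteq> \<mu> n" if "i \<in> F" for i
    using insert.hyps(2) assms(2) that by (metis injD)
  ultimately have F0: "\<forall>i\<in>F. c i = 0"
    by auto
  then have "c n *\<^sub>C v n = 0"
    using sum0 by simp
  then show ?case
    using F0 v(2) by simp
qed auto

text \<open>Passing from \<open>w\<close> to \<open>S w - \<mu> k *\<^sub>C w\<close> multiplies the
  value of each \<open>\<phi> j\<close> by \<open>\<mu> j - \<mu> k\<close>. This kills
  \<open>\<phi> k\<close>, keeps earlier zeros, and leaves \<open>\<phi> n\<close> nonzero.\<close>

lemma eigenfunctionals_dual_vector:
  fixes \<phi> :: "nat \<Rightarrow> 'a::complex_normed_vector \<Rightarrow> complex"
  assumes "inj \<mu>" "\<And>n. \<phi> n \<in> dual" "\<And>n x. \<phi> n (S x) = \<mu> n * \<phi> n x"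
    and "\<exists>x. \<phi> n x \<noteq> 0" "finite F" "n \<notin> F"
  shows "\<exists>w. \<phi> n w \<noteq> 0 \<and> (\<forall>k\<in>F. \<phi> k w = 0)"
  using assms(5,6)
proof (induction F)
  case empty
  then show ?case
    using assms(4) by simp
next
  case (insert k F)
  then obtain w where w: "\<phi> n w \<noteq> 0" "\<forall>k\<in>F. \<phi> k w = 0"
    by auto
  have eq: "\<phi> j (S w - \<mu> k *\<^sub>C w) = (\<mu> j - \<mu> k) * \<phi> j w" for j
    using assms(2)[of j] assms(3)[of j w]
    by (simp add: dual_def clin_diff clin_scale scaleC_complex_def left_diff_distrib)
  have "\<mu> n \<noteq> \<mu> k"
    using insert.prems assms(1) by (metis injD insertI1)
  then show ?case
    using w by (intro exI[of _ "S w - \<mu> k *\<^sub>C w"]) (auto simp: eq)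
qed

lemma invariant_half_space_of_eigenvalues:
  fixes S :: "'a::complex_normed_vector \<Rightarrow> 'a"
  assumes S: "bounded_clinear S" and "inj (\<mu> :: nat \<Rightarrow> complex)"
    and v: "\<And>n. S (v n) = \<mu> n *\<^sub>C v n" "\<And>n. v n \<noteq> 0"
    and \<phi>: "\<And>n. \<phi> n \<in> dual" "\<And>n x. \<phi> n (S x) = \<mu> n * \<phi> n x" "\<And>n. \<exists>x. \<phi> n x \<noteq> 0"
  obtains Y where "half_space Y" "S ` Y \<subseteq> Y"
proof
  \<comment> \<open>Splitting by parity: the even functionals force infinite codimension, while the
    odd eigenvectors stay in \<open>Y\<close> and force infinite dimension.\<close>
  define Y where "Y = {x. \<forall>n. \<phi> (2 * n) x = 0}"
  have inj: "inj (\<lambda>n. \<mu> (2 * n))" "inj (\<lambda>n. \<mu> (2 * n + 1))"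
    by (rule injI, drule injD[OF assms(2)], simp)+
  have Y: "closed_csubspace Y"
    unfolding Y_def by (rule closed_csubspace_common_kernel) (rule \<phi>)
  then have subY: "csubspace Y"
    by (simp add: closed_csubspace_def)
  \<comment> \<open>Evaluating \<open>\<phi> n (S (v m))\<close> from both sides shows that
    eigenvectors and eigenfunctionals of different eigenvalues annihilate each other.\<close>
  have "\<phi> n (v m) = 0" if "n \<noteq> m" for n m
  proof -
    have "\<mu> n * \<phi> n (v m) = \<phi> n (\<mu> m *\<^sub>C v m)"
      using \<phi>(2)[of n "v m"] v(1) by simp
    also have "\<dots> = \<mu> m * \<phi> n (v m)"
      using \<phi>(1)[of n] by (simp add: dual_def clin_scale scaleC_complex_def)
    finally show ?thesis
      using that assms(2) by (auto dest: injD)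
  qed
  moreover have "2 * n \<noteq> 2 * m + 1" for n m :: nat
    by presburger
  ultimately have "range (\<lambda>n. v (2 * n + 1)) \<subseteq> Y"
    unfolding Y_def by blast
  then have 1: "\<not> finite_dim Y"
    by (rule not_finite_dim_independent_sequence[rotated])
      (rule eigenvectors_independent[OF S inj(2) v])
  have "\<exists>w. \<phi> (2 * n) w \<noteq> 0 \<and> (\<forall>k\<in>{..<n}. \<phi> (2 * k) w = 0)" for n
    by (rule eigenfunctionals_dual_vector[OF inj(1) \<phi>]) auto
  then obtain w where w: "\<And>n. \<phi> (2 * n) (w n) \<noteq> 0" "\<And>n k. k < n \<Longrightarrow> \<phi> (2 * k) (w n) = 0"
    by (metis lessThan_iff)
  have "\<not> finite_dim_quotient Y"
    by (rule not_finite_dim_quotient_triangular[OF \<phi>(1) w subY]) (auto simp: Y_def)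
  then show "half_space Y"
    using Y 1 by (simp add: half_space_def)
  show "S ` Y \<subseteq> Y"
    by (auto simp: Y_def \<phi>(2))
qed

section \<open>Half-spaces in an arbitrary infinite-dimensional space\<close>

lemma biorthogonal_system:
  assumes "\<not> finite_dim (UNIV :: 'a::complex_normed_vector set)"
  obtains x :: "nat \<Rightarrow> 'a::complex_normed_vector" and f where "\<And>n. f n \<in> dual" "\<And>n m. f n (x m) = (if n = m then 1 else 0)"
proof -
  \<comment> \<open>\<open>P h n r\<close> says that the pair \<open>r\<close> of a vector and a
    functional may be the \<open>n\<close>-th choice after the history \<open>h\<close>: it is
    normalised and orthogonal, in both directions, to all earlier pairs.\<close>
  define P :: "(nat \<Rightarrow> 'a \<times> ('a \<Rightarrow> complex)) \<Rightarrow> nat \<Rightarrow> 'a \<times> ('a \<Rightarrow> complex) \<Rightarrow> bool"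
    where "P h n r \<longleftrightarrow> snd r \<in> dual \<and> snd r (fst r) = 1 \<and>
      (\<forall>k<n. snd (h k) (fst r) = 0 \<and> snd r (fst (h k)) = 0)" for h n r
  have "\<exists>h. \<forall>n. P h n (h n)"
  proof (rule dependent_wellorder_choice)
    show "P h n r = P h' n r" if "\<And>k. k < n \<Longrightarrow> h k = h' k" for r h h' n
      using that by (auto simp: P_def)
    fix n h
    assume prev: "\<And>k. k < n \<Longrightarrow> P h k (h k)"
    define x where "x k = fst (h k)" for k
    define f where "f k = snd (h k)" for k
    have f: "bounded_clinear (f k)" if "k < n" for k
      using prev[OF that] by (simp add: P_def f_def dual_def)
    have bi: "f j (x k) = (if j = k then 1 else 0)" if "j < n" "k < n" for j k
      using prev[OF that(1)] prev[OF that(2)]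
      by (cases j k rule: linorder_cases) (auto simp: P_def f_def x_def)
    \<comment> \<open>The projection along the earlier vectors onto the common kernel of the earlier
      functionals. It is not zero, since otherwise finitely many vectors would span the
      space.\<close>
    define pr where "pr z = z - (\<Sum>k<n. f k z *\<^sub>C x k)" for z
    have "\<exists>z. pr z \<noteq> 0"
    proof (rule ccontr)
      assume "\<nexists>z. pr z \<noteq> 0"
      then have "z = (\<Sum>k<n. f k z *\<^sub>C x k)" for z
        by (simp add: pr_def)
      moreover have "(\<Sum>k<n. f k z *\<^sub>C x k) \<in> cspan (x ` {..<n})" for z
        by (intro complex_vector.span_sum complex_vector.span_scale complex_vector.span_base) auto
      ultimately have "cspan (x ` {..<n}) = UNIV"
        by (metis UNIV_eq_I)
      then show False
        using assms finite_dim_cspan[of "x ` {..<n}"] by simp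
    qed
    then obtain z where z: "pr z \<noteq> 0"
      by blast
    have f_pr: "f j (pr z) = 0" if "j < n" for j
    proof -
      have "f j (pr z) = f j z - (\<Sum>k<n. f k z * f j (x k))"
        using f[OF that]
        by (simp add: pr_def clin_diff clin_sum clin_scale scaleC_complex_def)
      also have "(\<Sum>k<n. f k z * f j (x k)) = (\<Sum>k<n. if k = j then f j z else 0)"
        by (intro sum.cong) (auto simp: bi that)
      finally show ?thesis
        using that by simp
    qed
    obtain g where g: "g \<in> dual" "g (pr z) = 1"
      using dual_nonzero_at[OF z] .
    \<comment> \<open>Subtracting multiples of the earlier functionals makes \<open>g\<close> vanish
      at the earlier vectors. The value 1 at \<open>pr z\<close> survives because all
      \<open>f k\<close> vanish there.\<close>
    define g' where "g' y = g y - (\<Sum>k<n. f k y *\<^sub>C g (x k))" for y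
    have "bounded_clinear g'"
      unfolding g'_def using g(1) f
      by (intro bounded_clinear_diff bounded_clinear_sum bounded_clinear_rank_one)
        (auto simp: dual_def)
    moreover have "g' (pr z) = 1"
      by (simp add: g'_def g(2) f_pr)
    moreover have "g' (x j) = 0" if "j < n" for j
    proof -
      have "(\<Sum>k<n. f k (x j) *\<^sub>C g (x k)) = (\<Sum>k<n. if k = j then g (x j) else 0)"
        by (intro sum.cong) (auto simp: bi that scaleC_complex_def)
      then show ?thesis
        using that by (simp add: g'_def)
    qed
    ultimately show "\<exists>r. P h n r"
      using f_pr by (intro exI[of _ "(pr z, g')"]) (auto simp: P_def dual_def f_def x_def)
  qed
  then obtain h where h: "\<And>n. P h n (h n)"
    by blast
  show thesis
  proof (rule that[of "\<lambda>n. snd (h n)" "\<lambda>n. fst (h n)"])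
    show "snd (h n) \<in> dual" for n
      using h[of n] by (simp add: P_def)
    show "snd (h n) (fst (h m)) = (if n = m then 1 else 0)" for n m
      using h[of n] h[of m] by (cases n m rule: linorder_cases) (auto simp: P_def)
  qed
qed

text \<open>The parity splitting again: the common kernel of the even functionals contains the odd
  vectors, and the even vectors are independent modulo it.\<close>

lemma half_space_exists:
  assumes "\<not> finite_dim (UNIV :: 'a::complex_normed_vector set)"
  obtains Y :: "'a::complex_normed_vector set" where "half_space Y"
proof -
  obtain x :: "nat \<Rightarrow> 'a" and f where f: "\<And>n. f n \<in> dual"
    and fx: "\<And>n m. f n (x m) = (if n = m then 1 else 0)"
    by (rule biorthogonal_system[OF assms]) (rule that)
  define Y where "Y = {x. \<forall>n. f (2 * n) x = 0}"
  have Y: "closed_csubspace Y"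
    unfolding Y_def by (rule closed_csubspace_common_kernel) (rule f)
  moreover have "\<not> finite_dim Y"
  proof (rule not_finite_dim_independent_sequence[where v = "\<lambda>n. x (2 * n + 1)"])
    show "\<forall>i\<in>F. c i = 0" if "finite F" "(\<Sum>i\<in>F. c i *\<^sub>C x (2 * i + 1)) = 0" for F c
      by (rule triangular_independent[where \<phi> = "\<lambda>n. f (2 * n + 1)"
            and w = "\<lambda>n. x (2 * n + 1)", OF f _ _ that])
        (simp_all add: fx)
    have "f (2 * n) (x (2 * m + 1)) = 0" for n m :: nat
      unfolding fx by (rule if_not_P) presburger
    then show "range (\<lambda>n. x (2 * n + 1)) \<subseteq> Y"
      unfolding Y_def by blast
  qed
  moreover have "\<not> finite_dim_quotient Y"
  proof (rule not_finite_dim_quotient_triangular[where \<phi> = "\<lambda>n. f (2 * n)"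
        and w = "\<lambda>n. x (2 * n)", OF f])
    show "csubspace Y"
      using Y by (simp add: closed_csubspace_def)
  qed (simp_all add: fx Y_def)
  ultimately show thesis
    by (rule that[unfolded half_space_def, OF conjI[OF _ conjI]])
qed

section \<open>Infinite-dimensional eigenspaces and algebraic operators\<close>

text \<open>\<open>B\<close> maps the kernel of the product into the finite-dimensional kernel of
  \<open>A\<close>. Preimages of generators of this image \<open>V\<close>, together with generators
  of the kernel of \<open>B\<close>, span the kernel of the product.\<close>

lemma finite_dim_kernel_compose:
  assumes A: "bounded_clinear A" and B: "bounded_clinear B"
    and fin: "finite_dim {x. A x = 0}" "finite_dim {x. B x = 0}"
  shows "finite_dim {x. A (B x) = 0}"
proof -
  obtain D where D: "finite D" "cspan D = {x. B x = 0}"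
    using fin(2) by (auto simp: finite_dim_def)
  define V where "V = {B x | x. A (B x) = 0}"
  have "csubspace V"
    unfolding complex_vector.subspace_def
  proof (intro conjI ballI allI)
    show "0 \<in> V"
      unfolding V_def by (intro CollectI exI[of _ 0]) (simp add: clin_0[OF A] clin_0[OF B])
    show "x + y \<in> V" if xy: "x \<in> V" "y \<in> V" for x y
    proof -
      obtain a b where "x = B a" "A (B a) = 0" "y = B b" "A (B b) = 0"
        using xy by (auto simp: V_def)
      then show ?thesis
        unfolding V_def by (intro CollectI exI[of _ "a + b"]) (simp add: clin_add[OF A] clin_add[OF B])
    qed
    show "c *\<^sub>C x \<in> V" if x: "x \<in> V" for c x
    proof -
      obtain a where "x = B a" "A (B a) = 0"
        using x by (auto simp: V_def)
      then show ?thesis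
        unfolding V_def
        by (intro CollectI exI[of _ "c *\<^sub>C a"]) (simp add: clin_scale[OF A] clin_scale[OF B])
    qed
  qed
  then have "finite_dim V"
    by (rule finite_dim_subspace[OF fin(1)]) (auto simp: V_def)
  then obtain C where C: "finite C" "cspan C = V"
    by (auto simp: finite_dim_def)
  have "\<forall>c\<in>C. \<exists>x. B x = c"
    using C(2) complex_vector.span_superset[of C] by (auto simp: V_def)
  then obtain g where g: "\<And>c. c \<in> C \<Longrightarrow> B (g c) = c"
    by metis
  have sub: "{x. A (B x) = 0} \<subseteq> cspan (g ` C \<union> D)"
  proof
    fix x
    assume "x \<in> {x. A (B x) = 0}"
    then have "B x \<in> cspan C"
      using C(2) by (auto simp: V_def)
    also have "cspan C \<subseteq> {y. \<exists>z\<in>cspan (g ` C). B z = y}"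
    proof (rule complex_vector.span_minimal)
      show "C \<subseteq> {y. \<exists>z\<in>cspan (g ` C). B z = y}"
      proof
        fix c
        assume "c \<in> C"
        then show "c \<in> {y. \<exists>z\<in>cspan (g ` C). B z = y}"
          by (intro CollectI bexI[of _ "g c"] g complex_vector.span_base imageI)
      qed
      show "csubspace {y. \<exists>z\<in>cspan (g ` C). B z = y}"
        unfolding complex_vector.subspace_def
      proof (intro conjI ballI allI CollectI)
        show "\<exists>z\<in>cspan (g ` C). B z = 0"
          by (intro bexI[of _ 0] clin_0[OF B] complex_vector.span_zero)
        show "\<exists>z\<in>cspan (g ` C). B z = x + y"
          if "x \<in> {y. \<exists>z\<in>cspan (g ` C). B z = y}" "y \<in> {y. \<exists>z\<in>cspan (g ` C). B z = y}" for x y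
          using that by (auto simp flip: clin_add[OF B] intro: complex_vector.span_add)
        show "\<exists>z\<in>cspan (g ` C). B z = c *\<^sub>C x"
          if "x \<in> {y. \<exists>z\<in>cspan (g ` C). B z = y}" for c x
          using that by (auto simp flip: clin_scale[OF B] intro: complex_vector.span_scale)
      qed
    qed
    finally obtain z where z: "z \<in> cspan (g ` C)" "B z = B x"
      by blast
    then have "x - z \<in> cspan D"
      by (simp add: D(2) clin_diff[OF B])
    then have "z + (x - z) \<in> cspan (g ` C \<union> D)"
      using z(1) complex_vector.span_mono[of _ "g ` C \<union> D"]
      by (intro complex_vector.span_add) auto
    then show "x \<in> cspan (g ` C \<union> D)"
      by simp
  qed
  have "finite (g ` C \<union> D)"
    using C(1) D(1) by simp
  moreover have "csubspace {x. A (B x) = 0}"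
    using closed_csubspace_ker[OF bounded_clinear_compose[OF A B]]
    by (simp only: closed_csubspace_def)
  ultimately show ?thesis
    using finite_dim_subspace[OF finite_dim_cspan _ sub] by blast
qed

text \<open>An eigenspace of infinite codimension is itself the required half-space. If the
  codimension is finite, \<open>N\<close> vanishes on a space of finite codimension, so it has
  finite rank, and every half-space works with the range of \<open>N\<close> as the error
  space.\<close>

lemma almost_invariant_half_space_of_infinite_eigenspace:
  fixes T :: "'a::complex_normed_vector \<Rightarrow> 'a"
  assumes "\<not> finite_dim (UNIV :: 'a set)" and T: "bounded_clinear T"
    and inf: "\<not> finite_dim {x. T x - \<mu> *\<^sub>C x = 0}"
  obtains Y where "half_space Y" "almost_invariant T Y"
proof -
  define N where "N = (\<lambda>x. T x - \<mu> *\<^sub>C x)"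
  have N: "bounded_clinear N"
    unfolding N_def by (intro bounded_clinear_diff bounded_clinear_scaleC T)
  define K where "K = {x. N x = 0}"
  have K: "closed_csubspace K" "\<not> finite_dim K"
    using closed_csubspace_ker[OF N] inf by (auto simp: K_def N_def)
  show thesis
  proof (cases "finite_dim_quotient K")
    case False
    have "almost_invariant T K"
      unfolding almost_invariant_def
    proof (intro conjI exI)
      show "closed_csubspace {0::'a}" "finite_dim {0::'a}"
        using closed_csubspace_zero finite_dim_cspan[of "{}"] by auto
      have "T x \<in> K" if "x \<in> K" for x
      proof -
        have "T x = \<mu> *\<^sub>C x"
          using that by (simp add: K_def N_def)
        then show ?thesis
          using that K(1) complex_vector.subspace_scale by (auto simp: closed_csubspace_def)
      qed
      then show "T ` K \<subseteq> {y + m | y m. y \<in> K \<and> m \<in> {0}}"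
        by auto
    qed (rule K)
    then show thesis
      using that K False by (auto simp: half_space_def)
  next
    case True
    then obtain B where B: "finite B" "\<And>x. \<exists>b\<in>cspan B. x - b \<in> K"
      using K(1) by (auto simp: closed_csubspace_def elim: finite_dim_quotientE)
    obtain Y :: "'a set" where Y: "half_space Y"
      using half_space_exists[OF assms(1)] .
    define M where "M = cspan (N ` B)"
    have N_span: "N b \<in> M" if "b \<in> cspan B" for b
    proof -
      have "cspan B \<subseteq> {x. N x \<in> M}"
      proof (rule complex_vector.span_minimal)
        show "B \<subseteq> {x. N x \<in> M}"
          by (auto simp: M_def intro: complex_vector.span_base)
        show "csubspace {x. N x \<in> M}"
          unfolding complex_vector.subspace_def M_def
          by (auto simp: clin_0[OF N] clin_add[OF N] clin_scale[OF N]
              intro: complex_vector.span_zero complex_vector.span_add complex_vector.span_scale)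
      qed
      then show ?thesis
        using that by auto
    qed
    have N_M: "N x \<in> M" for x
    proof -
      obtain b where b: "b \<in> cspan B" "x - b \<in> K"
        using B(2) by blast
      then have "N x = N b"
        by (simp add: K_def clin_diff[OF N])
      then show ?thesis
        using N_span b(1) by simp
    qed
    have "almost_invariant T Y"
      unfolding almost_invariant_def
    proof (intro conjI exI)
      show "closed_csubspace Y"
        using Y by (simp add: half_space_def)
      then have "\<mu> *\<^sub>C y \<in> Y" if "y \<in> Y" for y
        using that by (auto simp: closed_csubspace_def complex_vector.subspace_scale)
      moreover have "T y = \<mu> *\<^sub>C y + N y" for y
        by (simp add: N_def)
      ultimately show "T ` Y \<subseteq> {y + m | y m. y \<in> Y \<and> m \<in> M}"
        using N_M by blast
    qed (use B(1) in \<open>auto simp: M_def intro: closed_csubspace_cspan_finite finite_dim_cspan\<close>)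
    then show thesis
      using that Y by blast
  qed
qed

text \<open>Summing up to any bound on the degree allows polynomials of different degrees to be
  compared over one index set.\<close>

lemma poly_operator_eq_sum:
  assumes "degree p \<le> n"
  shows "poly_operator p T x = (\<Sum>i\<le>n. coeff p i *\<^sub>C (T ^^ i) x)"
  unfolding poly_operator_def
  by (rule sum.mono_neutral_left) (use assms in \<open>auto simp: coeff_eq_0\<close>)

lemma poly_operator_0 [simp]: "poly_operator 0 T x = 0"
  by (simp add: poly_operator_def)

lemma poly_operator_add: "poly_operator (p + q) T x = poly_operator p T x + poly_operator q T x"
proof -
  define n where "n = max (degree p) (degree q)"
  have "degree p \<le> n" "degree q \<le> n" "degree (p + q) \<le> n"
    using degree_add_le_max[of p q] by (auto simp: n_def)
  then show ?thesis
    by (simp add: poly_operator_eq_sum[of _ n] scaleC_add_left sum.distrib)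
qed

lemma poly_operator_smult: "poly_operator (smult c p) T x = c *\<^sub>C poly_operator p T x"
  by (simp add: poly_operator_eq_sum[of "smult c p" "degree p"] poly_operator_eq_sum[of p "degree p"]
      complex_vector.scale_sum_right scaleC_scaleC)

lemma poly_operator_pCons:
  assumes "bounded_clinear T"
  shows "poly_operator (pCons a p) T x = a *\<^sub>C x + T (poly_operator p T x)"
  by (simp add: poly_operator_eq_sum[of "pCons a p" "Suc (degree p)"]
      poly_operator_eq_sum[of p "degree p"] degree_pCons_le sum.atMost_Suc_shift
      clin_sum[OF assms] clin_scale[OF assms] del: sum.atMost_Suc)

lemma poly_operator_mult:
  assumes "bounded_clinear T"
  shows "poly_operator (p * q) T x = poly_operator p T (poly_operator q T x)"
  by (induction p)
    (auto simp: poly_operator_add poly_operator_smult poly_operator_pCons[OF assms])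

lemma bounded_clinear_poly_operator:
  assumes "bounded_clinear T"
  shows "bounded_clinear (poly_operator p T)"
proof (induction p)
  case 0
  then show ?case
    using bounded_clinear_zero by simp
next
  case (pCons a p)
  then show ?case
    using bounded_clinear_add[OF bounded_clinear_scaleC[of a] bounded_clinear_compose[OF assms]]
    by (simp add: poly_operator_pCons[OF assms, abs_def])
qed

text \<open>Over the complex numbers \<open>q\<close> splits into linear factors. Each factor has an
  eigenspace as its kernel, and finite-dimensionality of kernels passes to products.\<close>

lemma finite_dim_kernel_poly_operator:
  assumes T: "bounded_clinear T" and fin: "\<And>\<mu>. finite_dim {x. T x - \<mu> *\<^sub>C x = 0}"
    and "q \<noteq> 0"
  shows "finite_dim {x. poly_operator q T x = 0}"
  using assms(3)
proof (induction "degree q" arbitrary: q rule: less_induct)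
  case less
  show ?case
  proof (cases "degree q = 0")
    case True
    then obtain a where "q = [:a:]" "a \<noteq> 0"
      using less.prems by (metis degree_0_id pCons_0_0)
    then have "{x. poly_operator q T x = 0} = {0}"
      by (auto simp: poly_operator_pCons[OF T] clin_0[OF T])
    then show ?thesis
      using finite_dim_cspan[of "{}"] by simp
  next
    case False
    then obtain \<mu> where "poly q \<mu> = 0"
      using alg_closed_imp_poly_has_root[of q] by auto
    then obtain r where r: "q = [:- \<mu>, 1:] * r"
      by (metis poly_eq_0_iff_dvd dvdE)
    then have "r \<noteq> 0" "degree r < degree q"
      using less.prems by (auto simp: degree_mult_eq simp del: mult_pCons_left)
    then have fin_r: "finite_dim {x. poly_operator r T x = 0}"
      using less.hyps by blast
    have eq: "poly_operator [:- \<mu>, 1:] T = (\<lambda>x. T x - \<mu> *\<^sub>C x)"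
      by (auto simp: poly_operator_pCons[OF T] clin_0[OF T] scaleC_one)
    have "finite_dim {x. poly_operator [:- \<mu>, 1:] T x = 0}"
      unfolding eq by (rule fin)
    then have "finite_dim {x. poly_operator [:- \<mu>, 1:] T (poly_operator r T x) = 0}"
      by (rule finite_dim_kernel_compose[OF bounded_clinear_poly_operator[OF T]
            bounded_clinear_poly_operator[OF T] _ fin_r])
    then show ?thesis
      unfolding r poly_operator_mult[OF T] .
  qed
qed

text \<open>The kernel of \<open>poly_operator q T\<close> is the whole space, so some eigenspace
  must be infinite-dimensional.\<close>

lemma almost_invariant_half_space_of_algebraic:
  fixes T :: "'a::complex_normed_vector \<Rightarrow> 'a"
  assumes "\<not> finite_dim (UNIV :: 'a set)" and T: "bounded_clinear T"
    and "q \<noteq> 0" "\<And>x. poly_operator q T x = 0"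
  obtains Y where "half_space Y" "almost_invariant T Y"
proof -
  obtain \<mu> where "\<not> finite_dim {x. T x - \<mu> *\<^sub>C x = 0}"
    using finite_dim_kernel_poly_operator[OF T _ assms(3)] assms(1,4) by auto
  from almost_invariant_half_space_of_infinite_eigenspace[OF assms(1) T this] show thesis
    using that by blast
qed

section \<open>Riesz theory for operators invertible modulo compact ones\<close>

lemma compact_operator_convergent_subsequence:
  fixes x :: "nat \<Rightarrow> 'a::complex_normed_vector"
  assumes "compact_operator K" "\<And>n. norm (x n) \<le> C"
  shows "\<exists>r l. strict_mono (r :: nat \<Rightarrow> nat) \<and> (\<lambda>n. K (x (r n))) \<longlonglongrightarrow> l"
proof -
  have K: "bounded_clinear K"
    using assms(1) by (simp add: compact_operator_def)
  \<comment> \<open>The maximum with 1 makes the radius positive, so that the sequence can be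
    rescaled into the unit ball.\<close>
  define D where "D = max C 1"
  have D: "D > 0" "\<And>n. norm (x n) \<le> D"
    using assms(2) by (auto simp: D_def intro: max.coboundedI1)
  define c where "c = complex_of_real D"
  have c: "c \<noteq> 0"
    using D(1) by (simp add: c_def)
  have "K (inverse c *\<^sub>C x n) \<in> closure (K ` cball 0 1)" for n
  proof -
    have "inverse c *\<^sub>C x n \<in> cball 0 1"
      using D(1) D(2)[of n] by (simp add: norm_scaleC c_def norm_inverse divide_le_eq_1 flip: divide_inverse_commute)
    then show ?thesis
      by (intro subsetD[OF closure_subset] imageI)
  qed
  moreover have "seq_compact (closure (K ` cball 0 1))"
    using assms(1) by (simp add: compact_operator_def compact_imp_seq_compact)
  ultimately obtain r l where r: "strict_mono (r :: nat \<Rightarrow> nat)"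
    and "((\<lambda>n. K (inverse c *\<^sub>C x n)) \<circ> r) \<longlonglongrightarrow> l"
    by (metis seq_compactE)
  then have "(\<lambda>n. c *\<^sub>C K (inverse c *\<^sub>C x (r n))) \<longlonglongrightarrow> c *\<^sub>C l"
    by (intro clin_tendsto[OF bounded_clinear_scaleC]) (simp add: o_def)
  then have "(\<lambda>n. K (x (r n))) \<longlonglongrightarrow> c *\<^sub>C l"
    using c by (simp add: clin_scale[OF K] scaleC_scaleC scaleC_one)
  then show ?thesis
    using r by blast
qed

text \<open>Subtract from \<open>x\<close> an element of \<open>Z\<close> at less than twice the
  optimal distance and divide by that distance. The modulus of \<open>a\<close> is recorded because
  it later controls the image of the new vector under an operator.\<close>

lemma riesz_lemma_scaled:
  assumes "closed_csubspace Z" "x \<notin> Z"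
  obtains a z where "z \<in> Z" "cmod a = inverse (infdist x Z)"
    "norm (a *\<^sub>C (x - z)) \<le> 2" "1 \<le> infdist (a *\<^sub>C (x - z)) Z"
proof -
  have Z: "csubspace Z" "closed Z"
    using assms(1) by (auto simp: closed_csubspace_def)
  then have "Z \<noteq> {}"
    using complex_vector.subspace_0 by blast
  define d where "d = infdist x Z"
  have d: "d > 0"
    using Z(2) \<open>Z \<noteq> {}\<close> assms(2)
    by (metis d_def in_closed_iff_infdist_zero infdist_nonneg less_eq_real_def)
  then obtain z where z: "z \<in> Z" "norm (x - z) < 2 * d"
    using infdist_less_obtain[OF Z(1), of x "2 * d"] by (auto simp: d_def)
  define a where "a = complex_of_real (inverse d)"
  have a: "cmod a = inverse d"
    using d by (simp add: a_def norm_inverse norm_divide)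
  have "d \<le> infdist (x - z) Z"
    using infdist_subspace_add[OF Z(1), of "x - z" z] z(1) by (simp add: d_def)
  then have "1 \<le> inverse d * infdist (x - z) Z"
    using d by (simp add: field_simps)
  then have "1 \<le> infdist (a *\<^sub>C (x - z)) Z"
    by (simp only: infdist_subspace_scaleC[OF Z(1)] a)
  moreover have "inverse d * norm (x - z) \<le> 2"
    using z(2) d by (simp add: field_simps)
  then have "norm (a *\<^sub>C (x - z)) \<le> 2"
    by (simp only: norm_scaleC a)
  ultimately show thesis
    using that z(1) a d_def by blast
qed

lemma riesz_lemma:
  assumes "closed_csubspace Z" "csubspace W" "Z \<subseteq> W" "x \<in> W" "x \<notin> Z"
  obtains y where "y \<in> W" "norm y \<le> 2" "1 \<le> infdist y Z"
proof -
  obtain a z where z: "z \<in> Z" "norm (a *\<^sub>C (x - z)) \<le> 2" "1 \<le> infdist (a *\<^sub>C (x - z)) Z"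
    using riesz_lemma_scaled[OF assms(1,5)] by blast
  moreover have "a *\<^sub>C (x - z) \<in> W"
    using assms(2,3,4) z(1)
    by (meson complex_vector.subspace_diff complex_vector.subspace_scale subset_iff)
  ultimately show thesis
    using that by blast
qed

text \<open>\<open>B\<close> inverts \<open>A\<close> up to \<open>K\<close> from both sides, and
  commutation makes the ranges and kernels of the powers of \<open>A\<close> invariant under
  \<open>B\<close>. Compactness of \<open>K\<close> enters in the form of convergent
  subsequences.\<close>

locale invertible_modulo_compact =
  fixes A B K :: "'a::complex_banach \<Rightarrow> 'a"
  assumes A: "bounded_clinear A" and B: "bounded_clinear B"
    and commute: "A (B x) = B (A x)"
    and BA: "B (A x) = x - K x"
    and subseq: "(\<And>n. norm (y (n :: nat)) \<le> C) \<Longrightarrow>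
      \<exists>r l. strict_mono (r :: nat \<Rightarrow> nat) \<and> (\<lambda>n. K (y (r n))) \<longlonglongrightarrow> l"
begin

text \<open>Write \<open>y n\<close> as \<open>B (A (y n)) + K (y n)\<close>: the first term
  converges, the second does so along a subsequence.\<close>

lemma approximate_kernel:
  assumes "\<And>n. norm (y n) \<le> C" "(\<lambda>n. A (y n)) \<longlonglongrightarrow> a"
  obtains r l where "strict_mono (r :: nat \<Rightarrow> nat)" "(\<lambda>n. y (r n)) \<longlonglongrightarrow> l" "A l = a"
proof -
  obtain r k where r: "strict_mono (r :: nat \<Rightarrow> nat)" and k: "(\<lambda>n. K (y (r n))) \<longlonglongrightarrow> k"
    using subseq[of y C] assms(1) by blast
  have Ar: "(\<lambda>n. A (y (r n))) \<longlonglongrightarrow> a"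
    using LIMSEQ_subseq_LIMSEQ[OF assms(2) r] by (simp add: o_def)
  have "(\<lambda>n. B (A (y (r n))) + K (y (r n))) \<longlonglongrightarrow> B a + k"
    by (intro tendsto_add clin_tendsto[OF B] Ar k)
  then have lim: "(\<lambda>n. y (r n)) \<longlonglongrightarrow> B a + k"
    by (simp add: BA)
  have "A (B a + k) = a"
    using LIMSEQ_unique[OF clin_tendsto[OF A lim] Ar] .
  then show thesis
    using that r lim by blast
qed

text \<open>The map induced by \<open>A\<close> modulo its kernel is bounded below. Otherwise
  Riesz's lemma yields bounded vectors at distance at least 1 from the kernel with images tending to
  0, and a subsequence would converge to a kernel element.\<close>

lemma infdist_kernel_le:
  obtains c where "c > 0" "\<And>x. infdist x {x. A x = 0} \<le> c * norm (A x)"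
proof -
  define N where "N = {x. A x = 0}"
  have N: "closed_csubspace N"
    unfolding N_def by (rule closed_csubspace_ker[OF A])
  then have subN: "csubspace N"
    by (simp add: closed_csubspace_def)
  have "\<exists>n. \<forall>x. infdist x N \<le> real (Suc n) * norm (A x)"
  proof (rule ccontr)
    assume "\<not> ?thesis"
    then have neg: "\<exists>x. infdist x N > real (Suc n) * norm (A x)" for n
      by (auto simp: not_le)
    have "\<exists>y. norm y \<le> 2 \<and> 1 \<le> infdist y N \<and> norm (A y) \<le> inverse (real (Suc n))" for n
    proof -
      obtain x where x: "infdist x N > real (Suc n) * norm (A x)"
        using neg by blast
      then have d: "infdist x N > 0"
        by (meson le_less_trans mult_nonneg_nonneg norm_ge_zero of_nat_0_le_iff)
      then have "x \<notin> N"
        by auto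
      then obtain a z where z: "z \<in> N" "cmod a = inverse (infdist x N)"
        and y: "norm (a *\<^sub>C (x - z)) \<le> 2" "1 \<le> infdist (a *\<^sub>C (x - z)) N"
        using riesz_lemma_scaled[OF N] by blast
      define y where "y = a *\<^sub>C (x - z)"
      have "A y = a *\<^sub>C A x"
        using z(1) by (simp add: y_def clin_scale[OF A] clin_diff[OF A] N_def)
      then have "norm (A y) = norm (A x) / infdist x N"
        by (simp add: norm_scaleC z(2) divide_inverse mult.commute)
      also have "\<dots> \<le> inverse (real (Suc n))"
        using x d by (simp add: field_simps del: of_nat_Suc)
      finally show ?thesis
        using y unfolding y_def by blast
    qed
    then obtain y where y: "\<And>n. norm (y n) \<le> 2" "\<And>n. 1 \<le> infdist (y n) N"
      "\<And>n. norm (A (y n)) \<le> inverse (real (Suc n))"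
      by metis
    have "(\<lambda>n. A (y n)) \<longlonglongrightarrow> 0"
      by (rule Lim_null_comparison[OF _ LIMSEQ_inverse_real_of_nat]) (simp add: y(3) del: of_nat_Suc)
    then obtain r l where "(\<lambda>n. y (r n)) \<longlonglongrightarrow> l" "A l = 0"
      using approximate_kernel y(1) by metis
    then have lim: "(\<lambda>n. norm (y (r n) - l)) \<longlonglongrightarrow> 0" and l: "l \<in> N"
      by (auto simp: N_def LIM_zero tendsto_norm_zero)
    have "1 \<le> norm (y (r n) - l)" for n
      using y(2)[of "r n"] infdist_le[OF l, of "y (r n)"] by (simp add: dist_norm)
    then have "(1::real) \<le> 0"
      using LIMSEQ_le_const[OF lim] by blast
    then show False
      by simp
  qed
  then show thesis
    using that by (metis N_def of_nat_0_less_iff zero_less_Suc)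
qed

lemma closed_range: "closed (range A)"
  unfolding closed_sequential_limits
proof (intro allI impI, elim conjE)
  fix a l
  assume a: "\<forall>n. a n \<in> range A" and lim: "a \<longlonglongrightarrow> l"
  define N where "N = {x. A x = 0}"
  have subN: "csubspace N"
    using closed_csubspace_ker[OF A] by (simp add: N_def closed_csubspace_def)
  obtain c where c: "c > 0" "\<And>x. infdist x N \<le> c * norm (A x)"
    using infdist_kernel_le unfolding N_def by blast
  obtain M where M: "\<And>n. norm (a n) \<le> M"
    using convergent_imp_Bseq[OF convergentI[OF lim]] by (auto simp: Bseq_def)
  \<comment> \<open>Subtracting an almost nearest kernel element gives preimages of bounded norm, to
    which \<open>approximate_kernel\<close> applies.\<close>
  have "\<exists>y. norm y \<le> c * M + 1 \<and> A y = a n" for n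
  proof -
    obtain x where x: "a n = A x"
      using a by blast
    obtain z where z: "z \<in> N" "norm (x - z) < infdist x N + 1"
      using infdist_less_obtain[OF subN, of x "infdist x N + 1"] by auto
    have "infdist x N \<le> c * norm (a n)"
      using c(2)[of x] x by simp
    also have "\<dots> \<le> c * M"
      using c(1) M by simp
    finally have "norm (x - z) \<le> c * M + 1"
      using z(2) by linarith
    moreover have "A (x - z) = a n"
      using z(1) x by (simp add: clin_diff[OF A] N_def)
    ultimately show ?thesis
      by blast
  qed
  then obtain y where y: "\<And>n. norm (y n) \<le> c * M + 1" "\<And>n. A (y n) = a n"
    by metis
  have "(\<lambda>n. A (y n)) \<longlonglongrightarrow> l"
    using lim by (simp add: y(2))
  then obtain l' where "A l' = l"
    using approximate_kernel y(1) by metis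
  then show "l \<in> range A"
    by blast
qed

lemma bounded_clinear_funpow: "bounded_clinear (A ^^ n)"
proof (induction n)
  case 0
  then show ?case
    by (simp add: bounded_clinear_id id_def)
next
  case (Suc n)
  then show ?case
    using bounded_clinear_compose[OF A] by (simp add: o_def)
qed

lemma B_funpow: "B ((A ^^ n) x) = (A ^^ n) (B x)"
  by (induction n) (auto simp: commute[symmetric])

lemma no_separated_sequence:
  fixes y :: "nat \<Rightarrow> 'a"
  assumes "\<And>n. norm (y n) \<le> C" "\<And>m n. m < n \<Longrightarrow> 1 \<le> norm (K (y n) - K (y m))"
  shows False
proof -
  obtain r l where r: "strict_mono (r :: nat \<Rightarrow> nat)" and "(\<lambda>n. K (y (r n))) \<longlonglongrightarrow> l"
    using subseq[of y C] assms(1) by blast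
  then have "Cauchy (\<lambda>n. K (y (r n)))"
    by (intro LIMSEQ_imp_Cauchy)
  then obtain M where M: "\<And>m n. m \<ge> M \<Longrightarrow> n \<ge> M \<Longrightarrow> norm (K (y (r m)) - K (y (r n))) < 1"
    unfolding Cauchy_iff by (meson zero_less_one)
  have "1 \<le> norm (K (y (r (Suc M))) - K (y (r M)))"
    using r by (intro assms(2)) (simp add: strict_mono_Suc_iff)
  then show False
    using M[of "Suc M" M] by simp
qed

lemma injective_imp_bounded_below:
  assumes "\<And>x. A x = 0 \<Longrightarrow> x = 0"
  obtains c where "c > 0" "\<And>x. c * norm x \<le> norm (A x)"
proof -
  have "{x. A x = 0} = {0}"
    using assms clin_0[OF A] by auto
  then obtain c where c: "c > 0" "\<And>x. infdist x {0} \<le> c * norm (A x)"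
    using infdist_kernel_le by metis
  then have "inverse c * norm x \<le> norm (A x)" for x
    using c(2)[of x] by (simp add: field_simps)
  then show thesis
    using that[of "inverse c"] c(1) by simp
qed

text \<open>If \<open>x\<close> is outside the range, the ranges of the powers of \<open>A\<close>
  form a strictly decreasing chain of closed subspaces. Riesz's lemma picks \<open>y n\<close> in
  each of them away from the next, and then the vectors \<open>K (y n)\<close> are separated,
  against compactness.\<close>

lemma injective_imp_surjective:
  assumes inj: "\<And>x. A x = 0 \<Longrightarrow> x = 0"
  shows "surj A"
proof (rule ccontr)
  assume "\<not> surj A"
  then obtain x where x: "x \<notin> range A"
    by blast
  obtain c where c: "c > 0" "\<And>x. c * norm x \<le> norm (A x)"
    using injective_imp_bounded_below[OF inj] by blast
  define R where "R n = range (A ^^ n)" for n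
  have below: "c ^ n * norm x \<le> norm ((A ^^ n) x)" for n x
  proof (induction n)
    case (Suc n)
    have "c ^ Suc n * norm x \<le> c * norm ((A ^^ n) x)"
      using Suc c(1) by (simp add: mult.assoc)
    also have "\<dots> \<le> norm (A ((A ^^ n) x))"
      by (rule c(2))
    finally show ?case
      by simp
  qed simp
  have R: "closed_csubspace (R n)" for n
    unfolding closed_csubspace_def
  proof
    show "csubspace (R n)"
      unfolding complex_vector.subspace_def R_def
    proof (intro conjI ballI allI)
      show "0 \<in> range (A ^^ n)"
        using clin_0[OF bounded_clinear_funpow] by (metis rangeI)
    next
      fix u v
      assume "u \<in> range (A ^^ n)" "v \<in> range (A ^^ n)"
      then show "u + v \<in> range (A ^^ n)"
        by (auto simp flip: clin_add[OF bounded_clinear_funpow])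
    next
      fix k u
      assume "u \<in> range (A ^^ n)"
      then show "k *\<^sub>C u \<in> range (A ^^ n)"
        by (auto simp flip: clin_scale[OF bounded_clinear_funpow])
    qed
    \<comment> \<open>Being bounded below by \<open>c ^ n\<close>, the \<open>n\<close>-th power has
      a complete, hence closed, range.\<close>
    have "complete (range (A ^^ n))"
      by (rule complete_isometric_image[where e = "c ^ n"])
        (use c(1) below in \<open>auto intro: bounded_clinear_imp_bounded_linear bounded_clinear_funpow
          simp: complete_UNIV\<close>)
    then show "closed (R n)"
      by (simp add: R_def complete_imp_closed)
  qed
  have subR: "csubspace (R n)" for n
    using R by (simp add: closed_csubspace_def)
  have decr: "R n \<subseteq> R m" if "m \<le> n" for m n
  proof -
    have "A ^^ n = (A ^^ m) \<circ> (A ^^ (n - m))"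
      using that by (metis funpow_add le_add_diff_inverse)
    then show ?thesis
      by (auto simp: R_def)
  qed
  have B_R: "B u \<in> R n" if "u \<in> R n" for u n
    using that by (auto simp: R_def B_funpow)
  have A_R: "A u \<in> R (Suc n)" if "u \<in> R n" for u n
    using that by (auto simp: R_def)
  have x_R: "(A ^^ n) x \<notin> R (Suc n)" for n
  proof
    assume "(A ^^ n) x \<in> R (Suc n)"
    then obtain z where "(A ^^ n) x = (A ^^ n) (A z)"
      by (auto simp: R_def funpow_swap1)
    then have "c ^ n * norm (x - A z) \<le> 0"
      using below[of n "x - A z"] by (simp add: clin_diff[OF bounded_clinear_funpow])
    then have "x = A z"
      using zero_less_power[OF c(1), of n] by (simp add: mult_le_0_iff)
    then show False
      using x by blast
  qed
  have "\<exists>y. y \<in> R n \<and> norm y \<le> 2 \<and> 1 \<le> infdist y (R (Suc n))" for n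
    using riesz_lemma[OF R[of "Suc n"] subR[of n] decr[of n "Suc n"] _ x_R[of n]]
    by (metis R_def lessI less_imp_le rangeI)
  then obtain y where y: "\<And>n. y n \<in> R n" "\<And>n. norm (y n) \<le> 2" "\<And>n. 1 \<le> infdist (y n) (R (Suc n))"
    by metis
  have "1 \<le> norm (K (y n) - K (y m))" if "m < n" for m n
  proof -
    have "y n \<in> R (Suc m)"
      using y(1)[of n] decr[of "Suc m" n] that by auto
    moreover have "B (A (y m)) \<in> R (Suc m)" "B (A (y n)) \<in> R (Suc m)"
      using B_R A_R y(1) decr[of "Suc m" "Suc n"] that by auto
    \<comment> \<open>\<open>?w\<close> is chosen so that \<open>y m - ?w\<close> equals
      \<open>K (y m) - K (y n)\<close>. All its terms lie in \<open>R (Suc m)\<close>, from which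
      \<open>y m\<close> has distance at least 1.\<close>
    ultimately have "B (A (y m)) + y n - B (A (y n)) \<in> R (Suc m)" (is "?w \<in> _")
      using subR by (intro complex_vector.subspace_diff complex_vector.subspace_add)
    then have "1 \<le> norm (y m - ?w)"
      using y(3)[of m] infdist_le[of ?w "R (Suc m)" "y m"] by (simp add: dist_norm)
    also have "y m - ?w = - (K (y n) - K (y m))"
      by (simp add: BA)
    finally show ?thesis
      by (simp add: norm_minus_commute)
  qed
  then show False
    using no_separated_sequence y(2) by blast
qed

text \<open>The counterpart with kernels: a nonzero \<open>v\<close> in the kernel has a preimage
  under each power of the surjective \<open>A\<close>, so the kernels of the powers increase
  strictly, and Riesz's lemma again separates the \<open>K (y n)\<close>.\<close>

lemma surjective_imp_injective:
  assumes "surj A" "A v = 0"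
  shows "v = 0"
proof (rule ccontr)
  assume v: "v \<noteq> 0"
  define N where "N n = {x. (A ^^ n) x = 0}" for n
  have N: "closed_csubspace (N n)" for n
    unfolding N_def by (rule closed_csubspace_ker[OF bounded_clinear_funpow])
  then have subN: "csubspace (N n)" for n
    by (simp add: closed_csubspace_def)
  have incr: "N m \<subseteq> N n" if "m \<le> n" for m n
  proof -
    have "A ^^ n = (A ^^ (n - m)) \<circ> (A ^^ m)"
      using that by (metis funpow_add le_add_diff_inverse2)
    then show ?thesis
      by (auto simp: N_def clin_0[OF bounded_clinear_funpow])
  qed
  have BA_N: "B (A u) \<in> N n" if "u \<in> N (Suc n)" for u n
    using that by (auto simp: N_def B_funpow[symmetric] clin_0[OF B] funpow_swap1)
  have "\<exists>y. y \<in> N (Suc n) \<and> norm y \<le> 2 \<and> 1 \<le> infdist y (N n)" for n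
  proof -
    have "surj (A ^^ n)"
      using assms(1) by (rule surj_fn)
    then obtain w where "v = (A ^^ n) w"
      by blast
    then have "w \<in> N (Suc n)" "w \<notin> N n"
      using v assms(2) by (auto simp: N_def)
    then show ?thesis
      using riesz_lemma[OF N subN incr[of n "Suc n"]] by (metis lessI less_imp_le)
  qed
  then obtain y where y: "\<And>n. y n \<in> N (Suc n)" "\<And>n. norm (y n) \<le> 2" "\<And>n. 1 \<le> infdist (y n) (N n)"
    by metis
  have "1 \<le> norm (K (y n) - K (y m))" if "m < n" for m n
  proof -
    have "y m \<in> N n" "B (A (y m)) \<in> N n" "B (A (y n)) \<in> N n"
      using y(1)[of m] y(1)[of n] incr[of "Suc m" n] incr[of m n] BA_N that by auto
    then have "B (A (y n)) + y m - B (A (y m)) \<in> N n" (is "?w \<in> _")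
      using subN by (intro complex_vector.subspace_diff complex_vector.subspace_add)
    then have "1 \<le> norm (y n - ?w)"
      using y(3)[of n] infdist_le[of ?w "N n" "y n"] by (simp add: dist_norm)
    also have "y n - ?w = K (y n) - K (y m)"
      by (simp add: BA)
    finally show ?thesis .
  qed
  then show False
    using no_separated_sequence y(2) by blast
qed

text \<open>An eigenvector prevents surjectivity, and the range is closed, so a nonzero functional
  annihilates it. For \<open>A\<close> of the form \<open>T\<close> minus \<open>\<mu>\<close> this
  is an eigenfunctional of the adjoint.\<close>

lemma functional_vanishing_on_range:
  assumes "A v = 0" "v \<noteq> 0"
  obtains f where "f \<in> dual" "\<And>x. f (A x) = 0" "\<exists>x. f x \<noteq> 0"
proof -
  obtain u where u: "u \<notin> range A"
    using surjective_imp_injective[of v] assms by blast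
  have "csubspace (range A)"
    unfolding complex_vector.subspace_def
  proof (intro conjI ballI allI)
    show "0 \<in> range A"
      using clin_0[OF A] by (metis rangeI)
  next
    fix u v
    assume "u \<in> range A" "v \<in> range A"
    then show "u + v \<in> range A"
      by (auto simp flip: clin_add[OF A])
  next
    fix k u
    assume "u \<in> range A"
    then show "k *\<^sub>C u \<in> range A"
      by (auto simp flip: clin_scale[OF A])
  qed
  then have "closed_csubspace (range A)"
    using closed_range by (simp add: closed_csubspace_def)
  then obtain f where "f \<in> dual" "\<And>w. w \<in> range A \<Longrightarrow> f w = 0" "f u = 1"
    using u dual_vanishing_on_subspace by blast
  then show thesis
    using that[of f] by force
qed

end

text \<open>Since X - \<mu> divides p - p(\<mu>) and p(\<mu>) is nonzero, there is \<open>q\<close>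
  with q (X - \<mu>) = 1 - p / p(\<mu>). Inserting \<open>T\<close> gives the inverse modulo the
  compact operator p(T) / p(\<mu>).\<close>

lemma invertible_modulo_compact_poly:
  fixes T :: "'a::complex_banach \<Rightarrow> 'a"
  assumes T: "bounded_clinear T" and comp: "compact_operator (poly_operator p T)"
    and "poly p \<mu> \<noteq> 0"
  shows "\<exists>B K. invertible_modulo_compact (\<lambda>x. T x - \<mu> *\<^sub>C x) B K"
proof -
  define A where "A = (\<lambda>x. T x - \<mu> *\<^sub>C x)"
  define q where "q = smult (- inverse (poly p \<mu>)) (synthetic_div p \<mu>)"
  define K where "K = (\<lambda>x. inverse (poly p \<mu>) *\<^sub>C poly_operator p T x)"
  have A_eq: "A = poly_operator [:- \<mu>, 1:] T"
    by (auto simp: A_def poly_operator_pCons[OF T] clin_0[OF T] scaleC_one)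
  have "q * [:- \<mu>, 1:] = smult (- inverse (poly p \<mu>)) ([:- \<mu>, 1:] * synthetic_div p \<mu>)"
    unfolding q_def mult_smult_left by (simp only: mult.commute)
  also have "[:- \<mu>, 1:] * synthetic_div p \<mu> = p - [:poly p \<mu>:]"
    using synthetic_div_correct'[of \<mu> p] by (simp add: eq_diff_eq)
  also have "smult (- inverse (poly p \<mu>)) (p - [:poly p \<mu>:]) =
      1 + smult (- inverse (poly p \<mu>)) p"
    using assms(3) by (simp add: smult_diff_right one_pCons)
  finally have q: "q * [:- \<mu>, 1:] = 1 + smult (- inverse (poly p \<mu>)) p" .
  have "invertible_modulo_compact A (poly_operator q T) K"
  proof
    show "bounded_clinear A" "bounded_clinear (poly_operator q T)"
      unfolding A_eq by (rule bounded_clinear_poly_operator[OF T])+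
    show "A (poly_operator q T x) = poly_operator q T (A x)" for x
      unfolding A_eq by (metis mult.commute poly_operator_mult[OF T])
    have "poly_operator q T (A x) = poly_operator (1 + smult (- inverse (poly p \<mu>)) p) T x" for x
      by (simp only: A_eq poly_operator_mult[OF T] flip: q)
    moreover have "poly_operator 1 T x = x" for x
      by (simp add: one_pCons poly_operator_pCons[OF T] clin_0[OF T] scaleC_one)
    ultimately show "poly_operator q T (A x) = x - K x" for x
      by (simp only: poly_operator_add poly_operator_smult) (simp add: K_def)
    show "\<exists>r l. strict_mono (r :: nat \<Rightarrow> nat) \<and> (\<lambda>n. K (y (r n))) \<longlonglongrightarrow> l"
      if "\<And>n. norm (y n) \<le> C" for y :: "nat \<Rightarrow> 'a" and C
      using compact_operator_convergent_subsequence[OF comp, of y C] that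
        clin_tendsto[OF bounded_clinear_scaleC] unfolding K_def by blast
  qed
  then show ?thesis
    unfolding A_def by blast
qed

section \<open>The resolvent off a finite set\<close>

text \<open>A subspace that contains a ball contains every vector after scaling, so proper closed
  subspaces are nowhere dense, and Baire's theorem applies.\<close>

lemma avoid_countably_many_subspaces:
  fixes V :: "nat \<Rightarrow> 'a::complex_banach set"
  assumes "\<And>n. closed_csubspace (V n)" "\<And>n. V n \<noteq> UNIV"
  obtains e where "\<And>n. e \<notin> V n"
proof -
  have empty: "interior (V n) = {}" for n
  proof (rule ccontr)
    assume "interior (V n) \<noteq> {}"
    then obtain x r where r: "r > 0" "ball x r \<subseteq> V n"
      by (meson all_not_in_conv mem_interior)
    have sub: "csubspace (V n)"
      using assms(1) by (simp add: closed_csubspace_def)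
    have "y \<in> V n" for y
    proof -
      define t where "t = r / (2 * (norm y + 1))"
      have t: "t > 0"
        using r(1) by (simp add: t_def add_nonneg_pos)
      have pos: "2 * (norm y + 1) > 0"
        by (simp add: add_nonneg_pos)
      have "r * norm y < r * (2 * (norm y + 1))"
        using r(1) pos by (intro mult_strict_left_mono) (simp_all add: add_pos_nonneg)
      then have "t * norm y < r"
        using pos by (simp add: t_def pos_divide_less_eq)
      then have "x + t *\<^sub>R y \<in> ball x r"
        using t by (simp add: dist_norm)
      then have "x + t *\<^sub>R y \<in> V n" "x \<in> V n"
        using r by auto
      then have "inverse t *\<^sub>R ((x + t *\<^sub>R y) - x) \<in> V n"
        using csubspace_imp_subspace[OF sub] real_vector.subspace_diff real_vector.subspace_scale
        by blast
      then show ?thesis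
        using t by simp
    qed
    then show False
      using assms(2)[of n] by blast
  qed
  have "euclidean interior_of \<Union>(range V) = {}"
  proof (rule Baire_category_alt)
    show "closedin euclidean X \<and> euclidean interior_of X = {}" if "X \<in> range V" for X
      using that assms(1) empty by (auto simp: closed_csubspace_def)
  qed (simp_all add: completely_metrizable_space_euclidean)
  then have "\<Union>(range V) \<noteq> UNIV"
    using interior_UNIV by force
  then show thesis
    using that by blast
qed

text \<open>A power series of functionals takes the place of a category argument in the dual. For
  each \<open>m\<close> its value at \<open>v m\<close> is a nonzero holomorphic function of
  \<open>t\<close> with finitely many zeros in a closed disc. The disc is uncountable, so some
  \<open>t\<close> avoids all these zeros.\<close>

lemma dual_nonzero_at_countably_many:
  fixes v :: "nat \<Rightarrow> 'a::complex_normed_vector"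
  assumes "\<And>n. v n \<noteq> 0"
  obtains f where "f \<in> dual" "\<And>n. f (v n) \<noteq> 0"
proof -
  have "\<exists>g :: 'a \<Rightarrow> complex. bounded_clinear g \<and> g (v n) \<noteq> 0 \<and> (\<forall>x. norm (g x) \<le> norm x)" for n
  proof -
    obtain g where g: "g \<in> dual" "g (v n) = 1"
      using dual_nonzero_at[OF assms] .
    then have bg: "bounded_clinear g"
      by (simp add: dual_def)
    obtain K where K: "K > 0" "\<And>x. norm (g x) \<le> K * norm x"
      using clin_bound[OF bg] by blast
    define g' where "g' = (\<lambda>x. complex_of_real (inverse K) *\<^sub>C g x)"
    have "bounded_clinear g'"
      unfolding g'_def by (rule bounded_clinear_compose[OF bounded_clinear_scaleC bg])
    moreover have "norm (g' x) \<le> norm x" for x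
    proof -
      have "norm (g' x) = norm (g x) / K"
        using K(1) by (simp add: g'_def norm_scaleC norm_inverse norm_divide divide_inverse mult.commute)
      also have "\<dots> \<le> norm x"
        using K(1) K(2)[of x] by (simp add: pos_divide_le_eq mult.commute)
      finally show ?thesis .
    qed
    moreover have "g' (v n) \<noteq> 0"
      using K(1) g(2) by (simp add: g'_def scaleC_complex_def)
    ultimately show ?thesis
      by blast
  qed
  then obtain g :: "nat \<Rightarrow> 'a \<Rightarrow> complex"
    where g: "\<And>n. bounded_clinear (g n)" "\<And>n. g n (v n) \<noteq> 0"
    "\<And>n x. norm (g n x) \<le> norm x"
    by metis
  \<comment> \<open>Shifting the coefficients by one makes the series vanish at
    \<open>t = 0\<close>, so if it were constant in \<open>t\<close> it would be identically
    zero.\<close>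
  define a where "a x n = (case n of 0 \<Rightarrow> 0 | Suc m \<Rightarrow> g m x)" for x n
  have a_le: "norm (a x n) \<le> norm x" for x n
    using g(3) by (simp add: a_def split: nat.split)
  define f where "f t x = (\<Sum>n. a x n * t ^ n)" for t x
  have summ: "summable (\<lambda>n. norm (a x n * t ^ n))" if t: "norm t < 1" for t x
  proof (rule summable_comparison_test')
    show "summable (\<lambda>n. norm x * norm t ^ n)"
      using t by (intro summable_mult summable_geometric) simp
    show "norm (norm (a x n * t ^ n)) \<le> norm x * norm t ^ n" if "n \<ge> 0" for n
      using mult_right_mono[OF a_le[of x n], of "norm t ^ n"] by (simp add: norm_mult norm_power)
  qed
  have sums: "(\<lambda>n. a x n * t ^ n) sums f t x" if t: "norm t < 1" for t x
    unfolding f_def using summable_norm_cancel[OF summ[OF t]] by (rule summable_sums)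
  have f_lin: "bounded_clinear (f t)" if t: "norm t < 1" for t
  proof (rule bounded_clinearI)
    show "f t (x + y) = f t x + f t y" for x y
    proof -
      have "a (x + y) n * t ^ n = a x n * t ^ n + a y n * t ^ n" for n
        by (simp add: a_def clin_add[OF g(1)] algebra_simps split: nat.split)
      then show ?thesis
        using sums_unique2[OF sums[OF t, of "x + y"]] sums_add[OF sums[OF t, of x] sums[OF t, of y]]
        by simp
    qed
    show "f t (c *\<^sub>C x) = c *\<^sub>C f t x" for c x
    proof -
      have eq: "(\<lambda>n. a (c *\<^sub>C x) n * t ^ n) = (\<lambda>n. c * (a x n * t ^ n))"
        by (rule ext) (simp add: a_def clin_scale[OF g(1)] scaleC_complex_def split: nat.split)
      then show ?thesis
        using sums_unique2[OF sums[OF t, of "c *\<^sub>C x", unfolded eq] sums_mult[OF sums[OF t]]]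
        by (simp add: scaleC_complex_def)
    qed
    show "norm (f t x) \<le> (1 / (1 - norm t)) * norm x" for x
    proof -
      have geo: "(\<lambda>n. norm x * norm t ^ n) sums (norm x * (1 / (1 - norm t)))"
        using t by (intro sums_mult geometric_sums) simp
      have "norm (f t x) \<le> (\<Sum>n. norm (a x n * t ^ n))"
        unfolding f_def by (rule summable_norm[OF summ[OF t]])
      also have "\<dots> \<le> (\<Sum>n. norm x * norm t ^ n)"
      proof (rule suminf_le)
        show "norm (a x n * t ^ n) \<le> norm x * norm t ^ n" for n
          using mult_right_mono[OF a_le[of x n], of "norm t ^ n"] by (simp add: norm_mult norm_power)
      qed (use summ[OF t] sums_summable[OF geo] in auto)
      also have "\<dots> = norm x * (1 / (1 - norm t))"
        using geo by (simp add: sums_iff)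
      finally show ?thesis
        by (simp add: mult.commute)
    qed
  qed
  have "finite {t \<in> cball 0 (1/2). f t (v m) = 0}" for m
  proof (rule holomorphic_compact_finite_zeros)
    show "(\<lambda>t. f t (v m)) holomorphic_on ball 0 1"
      by (rule power_series_holomorphic[where a = "a (v m)"]) (use sums in simp)
    have f0: "f 0 (v m) = 0"
      using sums_unique2[OF sums[of 0 "v m"] powser_sums_zero] by (simp add: a_def)
    show "\<not> (\<lambda>t. f t (v m)) constant_on ball 0 1"
    proof
      assume "(\<lambda>t. f t (v m)) constant_on ball 0 1"
      then have zero: "f t (v m) = 0" if "norm t < 1" for t
        using that f0 unfolding constant_on_def by (metis dist_0_norm mem_ball zero_less_one norm_zero)
      obtain s where s: "s > 0" "\<And>z. z \<in> cball 0 s - {0} \<Longrightarrow> f z (v m) \<noteq> 0"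
      proof (rule powser_0_nonzero[of 1 0 "a (v m)" "\<lambda>t. f t (v m)" "Suc m"])
        show "a (v m) (Suc m) \<noteq> 0"
          using g(2) by (simp add: a_def)
      qed (use sums f0 in auto)
      define z where "z = complex_of_real (min s (1/2))"
      have "norm z \<le> s" "z \<noteq> 0" "norm z < 1"
        using s(1) by (auto simp: z_def)
      then show False
        using s(2)[of z] zero[of z] by simp
    qed
  qed auto
  then have count: "countable (\<Union>m. {t \<in> cball 0 (1/2). f t (v m) = 0})"
    by (simp add: countable_finite)
  have "uncountable (cball (0::complex) (1/2))"
    by (rule uncountable_cball) simp
  then have "\<not> cball 0 (1/2) \<subseteq> (\<Union>m. {t \<in> cball 0 (1/2). f t (v m) = 0})"
    using countable_subset[OF _ count] by (rule contrapos_nn)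
  then obtain t where "t \<in> cball 0 (1/2)" "t \<notin> (\<Union>m. {t \<in> cball 0 (1/2). f t (v m) = 0})"
    unfolding subset_iff by meson
  then have t: "t \<in> cball 0 (1/2)" "\<And>m. f t (v m) \<noteq> 0"
    by simp_all
  show thesis
  proof
    show "f t \<in> dual"
      using f_lin[of t] t(1) by (simp add: dual_def)
  qed (rule t)
qed

section \<open>The resolvent: identity, holomorphy and behaviour at infinity\<close>

locale resolvent_off_finite =
  fixes T :: "'a::complex_banach \<Rightarrow> 'a" and E :: "complex set"
  assumes T: "bounded_clinear T" and fin: "finite E"
    and surj: "\<mu> \<notin> E \<Longrightarrow> surj (\<lambda>x. \<mu> *\<^sub>C x - T x)"
    and below: "\<mu> \<notin> E \<Longrightarrow> \<exists>c>0. \<forall>x. c * norm x \<le> norm (\<mu> *\<^sub>C x - T x)"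
begin

text \<open>Off \<open>E\<close> this is the resolvent of \<open>T\<close>; on \<open>E\<close> its
  values carry no information.\<close>

definition R :: "complex \<Rightarrow> 'a \<Rightarrow> 'a" where
  "R \<mu> = inv (\<lambda>x. \<mu> *\<^sub>C x - T x)"

lemma resolvent_right: "\<mu> \<notin> E \<Longrightarrow> \<mu> *\<^sub>C R \<mu> y - T (R \<mu> y) = y"
  unfolding R_def using surj_f_inv_f[OF surj] by blast

lemma resolvent_inj:
  assumes "\<mu> \<notin> E" "\<mu> *\<^sub>C x - T x = \<mu> *\<^sub>C y - T y"
  shows "x = y"
proof -
  obtain c where c: "c > 0" "c * norm (x - y) \<le> norm (\<mu> *\<^sub>C (x - y) - T (x - y))"
    using below[OF assms(1)] by blast
  have "\<mu> *\<^sub>C (x - y) - T (x - y) = 0"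
    using assms(2) by (simp add: clin_diff[OF T] complex_vector.scale_right_diff_distrib algebra_simps)
  then show ?thesis
    using c by (simp add: mult_le_0_iff)
qed

lemma resolvent_left: "\<mu> \<notin> E \<Longrightarrow> R \<mu> (\<mu> *\<^sub>C x - T x) = x"
  using resolvent_inj resolvent_right by blast

lemma resolvent_eqI: "\<mu> \<notin> E \<Longrightarrow> \<mu> *\<^sub>C x - T x = y \<Longrightarrow> R \<mu> y = x"
  using resolvent_left by blast

lemma T_resolvent: "\<mu> \<notin> E \<Longrightarrow> T (R \<mu> y) = \<mu> *\<^sub>C R \<mu> y - y"
  using resolvent_right[of \<mu> y] by (simp add: algebra_simps)

lemma resolvent_add: "\<mu> \<notin> E \<Longrightarrow> R \<mu> (x + y) = R \<mu> x + R \<mu> y"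
  by (rule resolvent_eqI) (simp_all add: clin_add[OF T] T_resolvent scaleC_add_right)

lemma resolvent_scale: "\<mu> \<notin> E \<Longrightarrow> R \<mu> (c *\<^sub>C x) = c *\<^sub>C R \<mu> x"
  by (rule resolvent_eqI)
    (simp_all add: clin_scale[OF T] T_resolvent scaleC_scaleC mult.commute
      complex_vector.scale_right_diff_distrib)

lemma resolvent_T: "\<mu> \<notin> E \<Longrightarrow> R \<mu> (T x) = \<mu> *\<^sub>C R \<mu> x - x"
  by (rule resolvent_eqI)
    (simp_all add: clin_diff[OF T] clin_scale[OF T] T_resolvent
      complex_vector.scale_right_diff_distrib)

lemma norm_resolvent_le:
  assumes "\<mu> \<notin> E" "c > 0" "\<And>x. c * norm x \<le> norm (\<mu> *\<^sub>C x - T x)"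
  shows "norm (R \<mu> y) \<le> norm y / c"
  using assms(3)[of "R \<mu> y"] assms(1,2) by (simp add: resolvent_right pos_le_divide_eq mult.commute)

lemma bounded_clinear_resolvent:
  assumes "\<mu> \<notin> E"
  shows "bounded_clinear (R \<mu>)"
proof -
  obtain c where c: "c > 0" "\<And>x. c * norm x \<le> norm (\<mu> *\<^sub>C x - T x)"
    using below[OF assms] by blast
  show ?thesis
    by (rule bounded_clinearI[where K = "inverse c"])
      (use norm_resolvent_le[OF assms c] in
        \<open>auto simp: resolvent_add resolvent_scale assms divide_inverse mult.commute\<close>)
qed

lemma resolvent_identity:
  assumes "\<mu> \<notin> E" "\<nu> \<notin> E"
  shows "R \<mu> y - R \<nu> y = (\<nu> - \<mu>) *\<^sub>C R \<mu> (R \<nu> y)"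
proof -
  have "R \<nu> y = R \<mu> (\<mu> *\<^sub>C R \<nu> y - T (R \<nu> y))"
    by (rule resolvent_left[OF assms(1), symmetric])
  also have "\<mu> *\<^sub>C R \<nu> y - T (R \<nu> y) = y + (\<mu> - \<nu>) *\<^sub>C R \<nu> y"
    by (simp add: T_resolvent[OF assms(2)] complex_vector.scale_left_diff_distrib)
  also have "R \<mu> \<dots> = R \<mu> y + (\<mu> - \<nu>) *\<^sub>C R \<mu> (R \<nu> y)"
    by (simp only: resolvent_add[OF assms(1)] resolvent_scale[OF assms(1)])
  finally have eq: "R \<nu> y = R \<mu> y + (\<mu> - \<nu>) *\<^sub>C R \<mu> (R \<nu> y)" .
  have "b - a = - c" if "a = b + c" for a b c :: 'a
    using that by simp
  from this[OF eq] show ?thesis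
    by (simp flip: complex_vector.scale_minus_left)
qed

lemma eventually_not_E: "\<forall>\<^sub>F \<mu> in at \<nu>. \<mu> \<notin> E"
proof -
  have "\<forall>\<^sub>F \<mu> in nhds \<nu>. \<mu> \<in> - (E - {\<nu>})"
    using fin by (intro eventually_nhds_in_open open_Compl finite_imp_closed) auto
  then show ?thesis
    unfolding eventually_at_filter by (rule eventually_mono) auto
qed

lemma resolvent_tendsto:
  assumes "\<nu> \<notin> E"
  shows "((\<lambda>\<mu>. R \<mu> y) \<longlongrightarrow> R \<nu> y) (at \<nu>)"
proof -
  obtain c where c: "c > 0" "\<And>x. c * norm x \<le> norm (\<nu> *\<^sub>C x - T x)"
    using below[OF assms] by blast
  have near: "\<forall>\<^sub>F \<mu> in at \<nu>. dist \<mu> \<nu> < c / 2"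
    using c(1) unfolding eventually_at by (intro exI[of _ "c / 2"]) auto
  have "\<forall>\<^sub>F \<mu> in at \<nu>. norm (R \<mu> y - R \<nu> y) \<le> cmod (\<nu> - \<mu>) * (2 / c * norm (R \<nu> y))"
    using near eventually_not_E
  proof eventually_elim
    case (elim \<mu>)
    \<comment> \<open>Within distance c/2 of \<nu> half of the lower bound survives. So the
      resolvents are uniformly bounded there, and the resolvent identity gives convergence.\<close>
    have "c / 2 * norm x \<le> norm (\<mu> *\<^sub>C x - T x)" for x
    proof -
      have "\<nu> *\<^sub>C x - T x = (\<mu> *\<^sub>C x - T x) + (\<nu> - \<mu>) *\<^sub>C x"
        by (simp add: complex_vector.scale_left_diff_distrib)
      then have "norm (\<nu> *\<^sub>C x - T x) \<le> norm (\<mu> *\<^sub>C x - T x) + cmod (\<nu> - \<mu>) * norm x"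
        by (metis norm_scaleC norm_triangle_ineq)
      moreover have "cmod (\<nu> - \<mu>) * norm x \<le> c / 2 * norm x"
        using elim(1) by (intro mult_right_mono) (simp_all add: dist_norm norm_minus_commute)
      ultimately show ?thesis
        using c(2)[of x] by linarith
    qed
    then have "norm (R \<mu> (R \<nu> y)) \<le> norm (R \<nu> y) / (c / 2)"
      using c(1) elim(2) by (intro norm_resolvent_le) auto
    then have "norm (R \<mu> (R \<nu> y)) \<le> 2 / c * norm (R \<nu> y)"
      by (simp add: mult.commute)
    then show ?case
      unfolding resolvent_identity[OF elim(2) assms] norm_scaleC
      by (rule mult_left_mono) (rule norm_ge_zero)
  qed
  moreover have "((\<lambda>\<mu>. cmod (\<nu> - \<mu>) * (2 / c * norm (R \<nu> y))) \<longlongrightarrow> 0) (at \<nu>)"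
    by (rule tendsto_mult_left_zero) (auto intro!: tendsto_eq_intros)
  ultimately have "((\<lambda>\<mu>. R \<mu> y - R \<nu> y) \<longlongrightarrow> 0) (at \<nu>)"
    by (rule Lim_null_comparison)
  then show ?thesis
    by (simp add: LIM_zero_iff)
qed

text \<open>By the resolvent identity the difference quotient is
  \<open>- \<phi> (R \<mu> (R \<nu> y))\<close>, so continuity at the fixed vector
  \<open>R \<nu> y\<close> suffices.\<close>

lemma resolvent_has_derivative:
  assumes \<phi>: "\<phi> \<in> dual" and "\<nu> \<notin> E"
  shows "((\<lambda>\<mu>. \<phi> (R \<mu> y)) has_field_derivative - \<phi> (R \<nu> (R \<nu> y))) (at \<nu>)"
  unfolding has_field_derivative_iff
proof (rule Lim_transform_eventually)
  have \<phi>': "bounded_clinear \<phi>"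
    using \<phi> by (simp add: dual_def)
  show "((\<lambda>\<mu>. - \<phi> (R \<mu> (R \<nu> y))) \<longlongrightarrow> - \<phi> (R \<nu> (R \<nu> y))) (at \<nu>)"
    by (intro tendsto_minus clin_tendsto[OF \<phi>'] resolvent_tendsto assms)
  have "\<forall>\<^sub>F \<mu> in at \<nu>. \<mu> \<noteq> \<nu>"
    by (simp add: eventually_at_filter)
  then show "\<forall>\<^sub>F \<mu> in at \<nu>. - \<phi> (R \<mu> (R \<nu> y)) = (\<phi> (R \<mu> y) - \<phi> (R \<nu> y)) / (\<mu> - \<nu>)"
    using eventually_not_E
  proof eventually_elim
    case (elim \<mu>)
    have "\<phi> (R \<mu> y) - \<phi> (R \<nu> y) = (\<nu> - \<mu>) * \<phi> (R \<mu> (R \<nu> y))"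
      using resolvent_identity[OF elim(2) assms(2), of y]
      by (metis clin_diff[OF \<phi>'] clin_scale[OF \<phi>'] scaleC_complex_def)
    then show ?case
      using elim(1) by (simp add: field_simps)
  qed
qed

lemma resolvent_holomorphic:
  assumes "\<phi> \<in> dual"
  shows "(\<lambda>\<mu>. \<phi> (R \<mu> y)) holomorphic_on - E"
  unfolding holomorphic_on_open[OF open_Compl[OF finite_imp_closed[OF fin]]]
  using resolvent_has_derivative[OF assms] by blast

lemma resolvent_tendsto_0_at_infinity: "((\<lambda>\<mu>. R \<mu> y) \<longlongrightarrow> 0) at_infinity"
proof -
  obtain K where K: "K > 0" "\<And>x. norm (T x) \<le> K * norm x"
    using clin_bound[OF T] by blast
  obtain b where b: "\<And>\<mu>. \<mu> \<in> E \<Longrightarrow> norm \<mu> \<le> b"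
    using finite_imp_bounded[OF fin] by (auto simp: bounded_iff)
  have "\<forall>\<^sub>F \<mu> in at_infinity. norm (R \<mu> y) \<le> norm y * 2 / norm \<mu>"
    unfolding eventually_at_infinity
  proof (intro exI allI impI)
    fix \<mu> :: complex
    \<comment> \<open>The term \<open>2 * K\<close> makes the norm of \<open>T x\<close> at most
      half of that of \<open>\<mu> *\<^sub>C x\<close>; the remaining terms keep
      \<open>\<mu>\<close> away from \<open>E\<close>.\<close>
    assume \<mu>: "\<bar>b\<bar> + 2 * K + 1 \<le> norm \<mu>"
    then have "\<mu> \<notin> E"
      using b[of \<mu>] K(1) by auto
    moreover have "norm \<mu> / 2 * norm x \<le> norm (\<mu> *\<^sub>C x - T x)" for x
    proof -
      have "norm \<mu> * norm x - K * norm x \<le> norm (\<mu> *\<^sub>C x - T x)"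
        using K(2)[of x] norm_triangle_ineq2[of "\<mu> *\<^sub>C x" "T x"] by (simp add: norm_scaleC)
      moreover have "K * norm x \<le> norm \<mu> / 2 * norm x"
        using \<mu> by (intro mult_right_mono) auto
      moreover have "norm \<mu> * norm x = norm \<mu> / 2 * norm x + norm \<mu> / 2 * norm x"
        by simp
      ultimately show ?thesis
        by linarith
    qed
    moreover have "norm \<mu> / 2 > 0"
      using \<mu> K(1) by linarith
    ultimately have "norm (R \<mu> y) \<le> norm y / (norm \<mu> / 2)"
      by (intro norm_resolvent_le)
    then show "norm (R \<mu> y) \<le> norm y * 2 / norm \<mu>"
      by simp
  qed
  moreover have "((\<lambda>\<mu>::complex. norm y * 2 / norm \<mu>) \<longlongrightarrow> 0) at_infinity"
    by (intro tendsto_divide_0[OF tendsto_const] filterlim_at_top_imp_at_infinity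
        filterlim_norm_at_top)
  ultimately show ?thesis
    by (rule Lim_null_comparison)
qed

lemma eventually_not_E_at_infinity: "\<forall>\<^sub>F \<mu> in at_infinity. \<mu> \<notin> E"
proof -
  obtain b where b: "\<And>\<mu>. \<mu> \<in> E \<Longrightarrow> norm \<mu> \<le> b"
    using finite_imp_bounded[OF fin] by (auto simp: bounded_iff)
  then have "\<mu> \<notin> E" if "b + 1 \<le> norm \<mu>" for \<mu>
    using that by force
  then show ?thesis
    unfolding eventually_at_infinity by blast
qed

text \<open>Apply \<open>\<phi>\<close> to y = \<mu> R(\<mu>) y - T R(\<mu>) y: the first term
  vanishes by assumption, the second tends to 0 as \<mu> tends to infinity.\<close>

lemma functional_zero_if_resolvent_zero:
  assumes \<phi>: "\<phi> \<in> dual" and zero: "\<And>\<mu>. \<mu> \<notin> E \<Longrightarrow> \<phi> (R \<mu> y) = 0"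
  shows "\<phi> y = 0"
proof -
  have \<phi>': "bounded_clinear \<phi>"
    using \<phi> by (simp add: dual_def)
  have "((\<lambda>\<mu>. - \<phi> (T (R \<mu> y))) \<longlongrightarrow> - \<phi> (T 0)) at_infinity"
    by (intro tendsto_minus clin_tendsto[OF \<phi>'] clin_tendsto[OF T] resolvent_tendsto_0_at_infinity)
  moreover have "\<forall>\<^sub>F \<mu> in at_infinity. - \<phi> (T (R \<mu> y)) = \<phi> y"
    using eventually_not_E_at_infinity
  proof eventually_elim
    case (elim \<mu>)
    then show ?case
      using zero[OF elim]
      by (simp add: T_resolvent clin_diff[OF \<phi>'] clin_scale[OF \<phi>'] scaleC_complex_def)
  qed
  ultimately have "((\<lambda>\<mu>::complex. \<phi> y) \<longlongrightarrow> - \<phi> (T 0)) at_infinity"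
    by (rule Lim_transform_eventually)
  then have "\<phi> y = - \<phi> (T 0)"
    by (rule tendsto_unique[OF trivial_limit_at_infinity tendsto_const])
  then show ?thesis
    by (simp add: clin_0[OF T] clin_0[OF \<phi>'])
qed

text \<open>Moving one \<open>T\<close> past \<open>R \<mu>\<close> turns it into the factor \<mu>
  and leaves a term free of the resolvent. Iterating by Horner's scheme, these terms add up to the
  polynomial \<open>h\<close>.\<close>

lemma resolvent_poly_operator:
  assumes \<phi>: "\<phi> \<in> dual"
  shows "\<exists>h. \<forall>\<mu>. \<mu> \<notin> E \<longrightarrow>
    \<phi> (R \<mu> (poly_operator q T y)) = poly q \<mu> * \<phi> (R \<mu> y) + poly h \<mu>"
proof (induction q)
  case 0
  show ?case
  proof (intro exI[of _ 0] allI impI)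
    fix \<mu>
    assume "\<mu> \<notin> E"
    then show "\<phi> (R \<mu> (poly_operator 0 T y)) = poly 0 \<mu> * \<phi> (R \<mu> y) + poly 0 \<mu>"
      using \<phi> by (simp add: clin_0 bounded_clinear_resolvent dual_def)
  qed
next
  case (pCons a q)
  then obtain h where h: "\<And>\<mu>. \<mu> \<notin> E \<Longrightarrow>
      \<phi> (R \<mu> (poly_operator q T y)) = poly q \<mu> * \<phi> (R \<mu> y) + poly h \<mu>"
    by blast
  have \<phi>': "bounded_clinear \<phi>"
    using \<phi> by (simp add: dual_def)
  show ?case
  proof (intro exI[of _ "pCons (- \<phi> (poly_operator q T y)) h"] allI impI)
    fix \<mu>
    assume \<mu>: "\<mu> \<notin> E"
    show "\<phi> (R \<mu> (poly_operator (pCons a q) T y)) =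
        poly (pCons a q) \<mu> * \<phi> (R \<mu> y) + poly (pCons (- \<phi> (poly_operator q T y)) h) \<mu>"
      by (simp add: poly_operator_pCons[OF T] resolvent_add[OF \<mu>] resolvent_scale[OF \<mu>]
          resolvent_T[OF \<mu>] clin_add[OF \<phi>'] clin_diff[OF \<phi>'] clin_scale[OF \<phi>'] h[OF \<mu>]
          scaleC_complex_def algebra_simps)
  qed
qed

end

section \<open>Essential singularities of the resolvent\<close>

text \<open>Unless it vanishes near \<open>z\<close>, such a \<open>g\<close> is a holomorphic
  function times a power of w - z, whose exponent may be negative. All larger \<open>n\<close> are
  included so that one exponent can later serve every point of \<open>E\<close>.\<close>

lemma not_essential_imp_power_mult_tendsto:
  assumes "isolated_singularity_at g z" "not_essential g z"
  shows "\<exists>m. \<forall>n\<ge>m. \<exists>l. ((\<lambda>w. (w - z) ^ n * g w) \<longlongrightarrow> l) (at z)"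
proof -
  have "\<exists>m l. ((\<lambda>w. (w - z) ^ m * g w) \<longlongrightarrow> l) (at z)"
  proof (cases "\<exists>\<^sub>F w in at z. g w \<noteq> 0")
    case False
    then have "\<forall>\<^sub>F w in at z. 0 = (w - z) ^ 0 * g w"
      by (auto simp: not_frequently elim: eventually_mono)
    then have "((\<lambda>w. (w - z) ^ 0 * g w) \<longlongrightarrow> 0) (at z)"
      by (rule Lim_transform_eventually[OF tendsto_const])
    then show ?thesis
      by blast
  next
    case True
    define h where "h = zor_poly g z"
    define k where "k = zorder g z"
    obtain r where r: "r > 0" "h holomorphic_on cball z r"
      "\<And>w. w \<in> cball z r - {z} \<Longrightarrow> g w = h w * (w - z) powi k"
      using zorder_exist[OF assms True] unfolding h_def k_def by blast
    define m where "m = nat (- k)"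
    have "isCont h z"
      using holomorphic_on_imp_continuous_on[OF r(2)] r(1)
      by (simp add: continuous_on_interior)
    then have lim: "((\<lambda>w. (w - z) ^ nat (k + int m) * h w) \<longlongrightarrow> (z - z) ^ nat (k + int m) * h z) (at z)"
      by (intro tendsto_intros) (simp add: isCont_def)
    have "\<forall>\<^sub>F w in at z. w \<in> cball z r - {z}"
      using r(1) by (auto simp: eventually_at dist_commute intro!: exI[of _ r])
    then have ev: "\<forall>\<^sub>F w in at z. (w - z) ^ nat (k + int m) * h w = (w - z) ^ m * g w"
    proof eventually_elim
      case (elim w)
      then have "w - z \<noteq> 0"
        by auto
      then have "(w - z) ^ m * (w - z) powi k = (w - z) powi (int m + k)"
        by (simp add: power_int_add power_int_of_nat)
      also have "\<dots> = (w - z) ^ nat (k + int m)"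
        by (simp add: power_int_def m_def add.commute)
      finally show ?case
        by (simp add: r(3)[OF elim] mult.commute mult.left_commute)
    qed
    show ?thesis
      using Lim_transform_eventually[OF lim ev] by blast
  qed
  then obtain m l where l: "((\<lambda>w. (w - z) ^ m * g w) \<longlongrightarrow> l) (at z)"
    by blast
  have "\<exists>l. ((\<lambda>w. (w - z) ^ n * g w) \<longlongrightarrow> l) (at z)" if "n \<ge> m" for n
  proof -
    have "((\<lambda>w. (w - z) ^ (n - m) * ((w - z) ^ m * g w)) \<longlongrightarrow> (z - z) ^ (n - m) * l) (at z)"
      by (intro tendsto_intros l)
    moreover have "(w - z) ^ (n - m) * ((w - z) ^ m * g w) = (w - z) ^ n * g w" for w
      using that by (simp flip: mult.assoc power_add)
    ultimately show ?thesis
      by auto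
  qed
  then show ?thesis
    by blast
qed

text \<open>Translates between the singularities in the form used by Picard's theorem and the notion
  \<open>not_essential\<close>. The delicate case is \<open>l = 0\<close>, where \<open>g\<close>
  may have a pole or vanish identically nearby.\<close>

lemma not_essential_of_tendsto_inverse:
  assumes "isolated_singularity_at g z" "((inverse \<circ> g) \<longlongrightarrow> l) (at z)"
  shows "not_essential g z"
proof (cases "l = 0")
  case False
  have "((\<lambda>w. inverse ((inverse \<circ> g) w)) \<longlongrightarrow> inverse l) (at z)"
    by (rule tendsto_inverse[OF assms(2) False])
  then show ?thesis
    by (auto simp: not_essential_def o_def)
next
  case True
  obtain r where r: "r > 0" "g analytic_on ball z r - {z}"
    using assms(1) by (auto simp: isolated_singularity_at_def)
  have "\<forall>\<^sub>F w in at z. dist ((inverse \<circ> g) w) 0 < 1"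
    using tendstoD[OF assms(2), of 1] True by simp
  then obtain d where d: "d > 0" "\<And>w. w \<noteq> z \<Longrightarrow> dist w z < d \<Longrightarrow> norm (inverse (g w)) < 1"
    by (auto simp: eventually_at)
  define B where "B = ball z (min r d) - {z}"
  \<comment> \<open>As \<open>inverse 0 = 0\<close>, a small inverse means that \<open>g\<close> is
    either zero or large. Connectedness of the punctured disc then allows only one of the two
    alternatives.\<close>
  have B: "g w = 0 \<or> norm (g w) > 1" if "w \<in> B" for w
  proof -
    have "norm (inverse (g w)) < 1"
      using that by (intro d(2)) (auto simp: B_def dist_commute)
    then show ?thesis
      by (auto simp: norm_inverse inverse_less_1_iff)
  qed
  have near: "\<forall>\<^sub>F w in at z. w \<in> B"
    using r(1) d(1) by (auto simp: B_def eventually_at dist_commute intro!: exI[of _ "min r d"])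
  have "continuous_on B g"
    using r(2) by (intro holomorphic_on_imp_continuous_on analytic_imp_holomorphic)
      (auto simp: B_def elim: analytic_on_subset)
  moreover have "connected B"
    unfolding B_def by (intro connected_open_delete) auto
  ultimately have conn: "connected (g ` B)"
    by (rule connected_continuous_image)
  have "open (ball (0::complex) 1)" "open (- cball (0::complex) 1)"
    by auto
  moreover have "g ` B \<subseteq> ball 0 1 \<union> - cball 0 1" "ball 0 1 \<inter> - cball 0 1 \<inter> g ` B = {}"
    using B by force+
  ultimately consider "ball 0 1 \<inter> g ` B = {}" | "- cball 0 1 \<inter> g ` B = {}"
    using connectedD[OF conn, of "ball 0 1" "- cball 0 1"] by blast
  then show ?thesis
  proof cases
    case 1
    then have nz: "\<And>w. w \<in> B \<Longrightarrow> g w \<noteq> 0"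
      by force
    have "\<forall>\<^sub>F w in at z. inverse (g w) \<noteq> 0"
      using near by eventually_elim (simp add: nz)
    then have "filterlim (\<lambda>w. inverse (g w)) (at 0) (at z)"
      using assms(2) True by (intro filterlim_atI) (auto simp: o_def)
    then have "is_pole g z"
      by (simp add: is_pole_def filterlim_inverse_at_iff)
    then show ?thesis
      by (auto simp: not_essential_def)
  next
    case 2
    then have "g w = 0" if "w \<in> B" for w
      using B that by force
    with near have "\<forall>\<^sub>F w in at z. 0 = g w"
      by (auto elim: eventually_mono)
    then have "(g \<longlongrightarrow> 0) (at z)"
      by (rule Lim_transform_eventually[OF tendsto_const])
    then show ?thesis
      by (auto simp: not_essential_def)
  qed
qed

context resolvent_off_finite
begin

text \<open>The factor for \<open>n\<close> cancels poles up to order \<open>n\<close> at all points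
  of \<open>E\<close>. This is a countable family, so one vector and one functional can be in
  general position for all of it.\<close>

definition Q :: "nat \<Rightarrow> complex poly" where
  "Q n = (\<Prod>z\<in>E. [:- z, 1:] ^ n)"

lemma Q_nonzero: "Q n \<noteq> 0"
  using fin by (simp add: Q_def)

lemma poly_Q:
  assumes "z \<in> E"
  shows "poly (Q n) w = (w - z) ^ n * (\<Prod>a\<in>E - {z}. (w - a) ^ n)"
  using assms fin by (simp add: Q_def poly_prod poly_power prod.remove)

text \<open>If no point of \<open>E\<close> is an essential singularity of \<open>g \<mu> = \<phi> (R \<mu> e)\<close>, then \<open>Q n\<close> cancels
  its poles for some \<open>n\<close>. Since \<open>\<phi> (R \<mu> (Q n (T) e))\<close> differs from \<open>Q n\<close> times \<open>g\<close> by a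
  polynomial, it extends to an entire function that vanishes at infinity.\<close>

lemma essential_singularity_exists:
  assumes \<phi>: "\<phi> \<in> dual" and nonzero: "\<And>n. \<phi> (poly_operator (Q n) T e) \<noteq> 0"
  shows "\<exists>z\<in>E. (\<forall>l. \<not> ((\<lambda>\<mu>. \<phi> (R \<mu> e)) \<longlongrightarrow> l) (at z)) \<and>
    (\<forall>l. \<not> ((inverse \<circ> (\<lambda>\<mu>. \<phi> (R \<mu> e))) \<longlongrightarrow> l) (at z))"
proof (rule ccontr)
  assume none: "\<not> ?thesis"
  define g where "g = (\<lambda>\<mu>. \<phi> (R \<mu> e))"
  have holg: "g holomorphic_on - E"
    unfolding g_def by (rule resolvent_holomorphic[OF \<phi>])
  have iso: "isolated_singularity_at g z" for z
  proof -
    obtain r where r: "r > 0" "ball z r - {z} \<subseteq> - E"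
    proof -
      have "open (- (E - {z}))"
        using fin by (intro open_Compl finite_imp_closed) auto
      then obtain r where "r > 0" "ball z r \<subseteq> - (E - {z})"
        by (meson Compl_iff DiffE insertI1 openE)
      then show thesis
        using that[of r] by blast
    qed
    have "open (ball z r - {z})"
      by (intro open_Diff) auto
    then have "g analytic_on ball z r - {z}"
      using holomorphic_on_subset[OF holg r(2)] by (simp add: analytic_on_open)
    then show ?thesis
      using r(1) by (auto simp: isolated_singularity_at_def)
  qed
  have "\<exists>m. \<forall>n\<ge>m. \<exists>l. ((\<lambda>w. (w - z) ^ n * g w) \<longlongrightarrow> l) (at z)" if z: "z \<in> E" for z
  proof -
    have "(\<exists>l. (g \<longlongrightarrow> l) (at z)) \<or> (\<exists>l. ((inverse \<circ> g) \<longlongrightarrow> l) (at z))"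
      using none z unfolding g_def by blast
    then have "not_essential g z"
      using not_essential_of_tendsto_inverse[OF iso] by (auto simp: not_essential_def)
    then show ?thesis
      by (rule not_essential_imp_power_mult_tendsto[OF iso])
  qed
  then obtain m where m: "\<And>z n. z \<in> E \<Longrightarrow> n \<ge> m z \<Longrightarrow>
      \<exists>l. ((\<lambda>w. (w - z) ^ n * g w) \<longlongrightarrow> l) (at z)"
    by metis
  \<comment> \<open>The sum dominates every \<open>m z\<close>, so this exponent works at all points
    of \<open>E\<close> simultaneously.\<close>
  define n where "n = (\<Sum>z\<in>E. m z)"
  have n: "m z \<le> n" if "z \<in> E" for z
    unfolding n_def using fin that by (intro member_le_sum) auto
  define y where "y = poly_operator (Q n) T e"
  define k where "k = (\<lambda>\<mu>. \<phi> (R \<mu> y))"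
  obtain h where h: "\<And>\<mu>. \<mu> \<notin> E \<Longrightarrow> k \<mu> = poly (Q n) \<mu> * g \<mu> + poly h \<mu>"
    using resolvent_poly_operator[OF \<phi>, of "Q n" e] unfolding k_def g_def y_def by blast
  have "\<exists>l. (k \<longlongrightarrow> l) (at z)" if z: "z \<in> E" for z
  proof -
    obtain l where l: "((\<lambda>w. (w - z) ^ n * g w) \<longlongrightarrow> l) (at z)"
      using m[OF z n[OF z]] by blast
    have lim: "((\<lambda>w. (w - z) ^ n * g w * (\<Prod>a\<in>E - {z}. (w - a) ^ n) + poly h w) \<longlongrightarrow>
        l * (\<Prod>a\<in>E - {z}. (z - a) ^ n) + poly h z) (at z)"
      by (intro tendsto_intros l)
    have ev: "\<forall>\<^sub>F w in at z.
        (w - z) ^ n * g w * (\<Prod>a\<in>E - {z}. (w - a) ^ n) + poly h w = k w"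
      using eventually_not_E by eventually_elim (simp add: h poly_Q[OF z] mult.commute mult.left_commute)
    show ?thesis
      using Lim_transform_eventually[OF lim ev] by blast
  qed
  then obtain L where L: "\<And>z. z \<in> E \<Longrightarrow> (k \<longlongrightarrow> L z) (at z)"
    by metis
  \<comment> \<open>Filling in the limits removes the finitely many singularities and makes
    \<open>K\<close> entire, so that Liouville's theorem applies.\<close>
  define K where "K = (\<lambda>\<mu>. if \<mu> \<in> E then L \<mu> else k \<mu>)"
  have K_eq: "\<forall>\<^sub>F w in F. k w = K w" if "\<forall>\<^sub>F w in F. w \<notin> E" for F
    using that by eventually_elim (simp add: K_def)
  have "K holomorphic_on UNIV"
  proof (rule no_isolated_singularity'[OF _ _ open_UNIV fin])
    show "(K \<longlongrightarrow> K z) (at z within UNIV)" if "z \<in> E" for z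
      using Lim_transform_eventually[OF L[OF that] K_eq[OF eventually_not_E]] that
      by (simp add: K_def)
    have "k holomorphic_on - E"
      unfolding k_def by (rule resolvent_holomorphic[OF \<phi>])
    then show "K holomorphic_on UNIV - E"
      unfolding Compl_eq_Diff_UNIV by (rule holomorphic_transform) (simp add: K_def)
  qed
  moreover have "(k \<longlongrightarrow> \<phi> 0) at_infinity"
    unfolding k_def
    by (rule clin_tendsto[OF \<phi>[unfolded dual_def mem_Collect_eq] resolvent_tendsto_0_at_infinity])
  then have "(K \<longlongrightarrow> \<phi> 0) at_infinity"
    by (rule Lim_transform_eventually[OF _ K_eq[OF eventually_not_E_at_infinity]])
  ultimately have "K \<mu> = \<phi> 0" for \<mu>
    by (rule Liouville_weak)
  moreover have "\<phi> 0 = 0"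
    using \<phi> by (simp add: dual_def clin_0)
  ultimately have "\<phi> (R \<mu> y) = 0" if "\<mu> \<notin> E" for \<mu>
    using that by (metis K_def k_def)
  then have "\<phi> y = 0"
    by (rule functional_zero_if_resolvent_zero[OF \<phi>])
  then show False
    using nonzero unfolding y_def by blast
qed

text \<open>If \<open>\<phi> (R \<mu> e) = c\<close>, then \<open>R \<mu> e\<close> is an eigenvector and \<open>\<phi> \<circ> R \<mu>\<close> a left eigenvector of
  \<open>T + (\<phi> / c) e\<close>, both for the eigenvalue \<open>\<mu>\<close>.\<close>

lemma almost_invariant_half_space_of_not_algebraic:
  assumes "\<And>n. \<exists>x. poly_operator (Q n) T x \<noteq> 0"
  obtains Y where "half_space Y" "almost_invariant T Y"
proof -
  obtain e where e: "\<And>n. e \<notin> {x. poly_operator (Q n) T x = 0}"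
  proof (rule avoid_countably_many_subspaces[of "\<lambda>n. {x. poly_operator (Q n) T x = 0}"])
    show "closed_csubspace {x. poly_operator (Q n) T x = 0}" for n
      by (rule closed_csubspace_ker[OF bounded_clinear_poly_operator[OF T]])
    show "{x. poly_operator (Q n) T x = 0} \<noteq> UNIV" for n
      using assms by blast
  qed blast
  obtain \<phi> where \<phi>: "\<phi> \<in> dual" and "\<And>n. \<phi> (poly_operator (Q n) T e) \<noteq> 0"
    using dual_nonzero_at_countably_many[of "\<lambda>n. poly_operator (Q n) T e"] e by auto
  then obtain z where z: "z \<in> E" "\<And>l. \<not> ((\<lambda>\<mu>. \<phi> (R \<mu> e)) \<longlongrightarrow> l) (at z)"
    "\<And>l. \<not> ((inverse \<circ> (\<lambda>\<mu>. \<phi> (R \<mu> e))) \<longlongrightarrow> l) (at z)"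
    using essential_singularity_exists[of \<phi> e] by blast
  have \<phi>': "bounded_clinear \<phi>"
    using \<phi> by (simp add: dual_def)
  \<comment> \<open>An open set in which \<open>z\<close> is the only point of \<open>E\<close>, as
    Picard's theorem requires.\<close>
  define M where "M = - (E - {z})"
  have M: "z \<in> M" "M - {z} = - E"
    using z(1) by (auto simp: M_def)
  have "open M"
    unfolding M_def using fin by (intro open_Compl finite_imp_closed finite_Diff)
  have "(\<lambda>\<mu>. \<phi> (R \<mu> e)) holomorphic_on M - {z}"
    unfolding M(2) by (rule resolvent_holomorphic[OF \<phi>])
  then obtain a where a: "\<And>w. w \<noteq> a \<Longrightarrow> infinite {\<mu>. \<mu> \<in> M - {z} \<and> \<phi> (R \<mu> e) = w}"
    by (rule great_Picard_infinite[OF \<open>open M\<close> M(1) _ z(2,3)]) (rule that)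
  \<comment> \<open>Besides the possible exceptional value \<open>a\<close>, also 0 must be avoided,
    as the perturbation divides by \<open>c\<close>.\<close>
  obtain c where c: "c \<noteq> a" "c \<noteq> 0"
    using ex_new_if_finite[OF infinite_UNIV_char_0, of "{a, 0}"] by auto
  obtain \<mu> :: "nat \<Rightarrow> complex" where "inj \<mu>" and
    "range \<mu> \<subseteq> {\<mu>. \<mu> \<in> M - {z} \<and> \<phi> (R \<mu> e) = c}"
    using infinite_countable_subset[OF a[OF c(1)]] by blast
  then have \<mu>: "\<And>n. \<mu> n \<notin> E" "\<And>n. \<phi> (R (\<mu> n) e) = c"
    unfolding M(2) by auto
  define S where "S = (\<lambda>x. T x + \<phi> x *\<^sub>C inverse c *\<^sub>C e)"
  have S: "bounded_clinear S"
    unfolding S_def by (intro bounded_clinear_add T bounded_clinear_rank_one \<phi>')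
  obtain Y where Y: "half_space Y" "S ` Y \<subseteq> Y"
  proof (rule invariant_half_space_of_eigenvalues[OF S \<open>inj \<mu>\<close>])
    show "S (R (\<mu> n) e) = \<mu> n *\<^sub>C R (\<mu> n) e" for n
      using c(2) by (simp add: S_def T_resolvent[OF \<mu>(1)] \<mu>(2) scaleC_scaleC scaleC_one)
    show "R (\<mu> n) e \<noteq> 0" for n
      using \<mu>(2)[of n] c(2) clin_0[OF \<phi>'] by auto
    show "(\<lambda>x. \<phi> (R (\<mu> n) x)) \<in> dual" for n
      using bounded_clinear_compose[OF \<phi>' bounded_clinear_resolvent[OF \<mu>(1)]]
      by (simp add: dual_def)
    show "\<phi> (R (\<mu> n) (S x)) = \<mu> n * \<phi> (R (\<mu> n) x)" for n x
      using c(2)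
      by (simp add: S_def resolvent_add[OF \<mu>(1)] resolvent_scale[OF \<mu>(1)] resolvent_T[OF \<mu>(1)]
          clin_add[OF \<phi>'] clin_diff[OF \<phi>'] clin_scale[OF \<phi>'] \<mu>(2) scaleC_complex_def)
    show "\<exists>x. \<phi> (R (\<mu> n) x) \<noteq> 0" for n
      using \<mu>(2) c(2) by metis
  qed blast
  have "almost_invariant T Y"
    unfolding almost_invariant_def
  proof (intro conjI exI)
    show "closed_csubspace Y"
      using Y(1) by (simp add: half_space_def)
    show "closed_csubspace (cspan {e})" "finite_dim (cspan {e})"
      by (simp_all add: closed_csubspace_cspan_finite finite_dim_cspan)
    show "T ` Y \<subseteq> {y + m | y m. y \<in> Y \<and> m \<in> cspan {e}}"
    proof
      fix x
      assume "x \<in> T ` Y"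
      then obtain y where y: "y \<in> Y" "x = T y"
        by blast
      have "x = S y + (- (\<phi> y * inverse c)) *\<^sub>C e"
        by (simp add: y(2) S_def scaleC_scaleC)
      moreover have "S y \<in> Y"
        using y(1) Y(2) by blast
      moreover have "(- (\<phi> y * inverse c)) *\<^sub>C e \<in> cspan {e}"
        by (intro complex_vector.span_scale complex_vector.span_base) simp
      ultimately show "x \<in> {y + m | y m. y \<in> Y \<and> m \<in> cspan {e}}"
        by blast
    qed
  qed
  then show thesis
    using that Y(1) by blast
qed

end

section \<open>Combining the cases\<close>

lemma almost_invariant_of_invariant:
  assumes "half_space Y" "T ` Y \<subseteq> Y"
  shows "almost_invariant T Y"
  unfolding almost_invariant_def
proof (intro conjI exI)
  show "closed_csubspace {0::'a}" "finite_dim {0::'a}"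
    using closed_csubspace_zero finite_dim_cspan[of "{}"] by auto
qed (use assms in \<open>auto simp: half_space_def\<close>)

theorem corollary2p12:
  fixes T :: "'a::complex_banach \<Rightarrow> 'a"
  assumes "\<not> finite_dim (UNIV :: 'a set)"
    and "reflexive TYPE('a)"
    and "bounded_clinear T"
    and "polynomially_compact T"
  shows "\<exists>Y. half_space Y \<and> almost_invariant T Y"
proof -
  note T = assms(3)
  obtain p where p: "p \<noteq> 0" "compact_operator (poly_operator p T)"
    using assms(4) by (auto simp: polynomially_compact_def)
  define G where "G = {\<mu>. poly p \<mu> \<noteq> 0 \<and> (\<exists>v. v \<noteq> 0 \<and> T v = \<mu> *\<^sub>C v)}"
  show ?thesis
  proof (cases "finite G")
    case False
    then obtain \<mu> :: "nat \<Rightarrow> complex" where \<mu>: "inj \<mu>" "range \<mu> \<subseteq> G"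
      using infinite_countable_subset by blast
    then have "\<forall>n. \<exists>v. v \<noteq> 0 \<and> T v = \<mu> n *\<^sub>C v"
      by (auto simp: G_def)
    then obtain v where v: "\<And>n. v n \<noteq> 0" "\<And>n. T (v n) = \<mu> n *\<^sub>C v n"
      by metis
    \<comment> \<open>Riesz theory off the roots of \<open>p\<close> turns each eigenvalue of
      \<open>T\<close> into one of the adjoint.\<close>
    have "\<exists>\<phi>. \<phi> \<in> dual \<and> (\<forall>x. \<phi> (T x) = \<mu> n * \<phi> x) \<and> (\<exists>x. \<phi> x \<noteq> 0)" for n
    proof -
      have "poly p (\<mu> n) \<noteq> 0"
        using \<mu>(2) by (auto simp: G_def)
      then obtain B K where "invertible_modulo_compact (\<lambda>x. T x - \<mu> n *\<^sub>C x) B K"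
        using invertible_modulo_compact_poly[OF T p(2)] by blast
      then interpret invertible_modulo_compact "\<lambda>x. T x - \<mu> n *\<^sub>C x" B K .
      obtain \<phi> where \<phi>: "\<phi> \<in> dual" "\<And>x. \<phi> (T x - \<mu> n *\<^sub>C x) = 0" "\<exists>x. \<phi> x \<noteq> 0"
        using functional_vanishing_on_range[of "v n"] v by auto
      have "\<phi> (T x) = \<mu> n * \<phi> x" for x
        using \<phi>(1) \<phi>(2)[of x] by (simp add: dual_def clin_diff clin_scale scaleC_complex_def)
      then show ?thesis
        using \<phi> by blast
    qed
    then obtain \<phi> where \<phi>: "\<And>n. \<phi> n \<in> dual" "\<And>n x. \<phi> n (T x) = \<mu> n * \<phi> n x"
      "\<And>n. \<exists>x. \<phi> n x \<noteq> 0"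
      by metis
    obtain Y where "half_space Y" "T ` Y \<subseteq> Y"
      by (rule invariant_half_space_of_eigenvalues[OF T \<mu>(1) v(2,1) \<phi>])
    then show ?thesis
      using almost_invariant_of_invariant by blast
  next
    case True
    \<comment> \<open>A finite set containing the spectrum: off the roots of \<open>p\<close>, Riesz
      theory leaves eigenvalues as the only obstruction to bounded invertibility.\<close>
    define E where "E = G \<union> {\<mu>. poly p \<mu> = 0}"
    have invertible: "surj (\<lambda>x. \<mu> *\<^sub>C x - T x) \<and> (\<exists>c>0. \<forall>x. c * norm x \<le> norm (\<mu> *\<^sub>C x - T x))"
      if "\<mu> \<notin> E" for \<mu>
    proof -
      have nz: "poly p \<mu> \<noteq> 0" and inj: "\<And>x. T x - \<mu> *\<^sub>C x = 0 \<Longrightarrow> x = 0"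
        using that by (auto simp: E_def G_def)
      obtain B K where "invertible_modulo_compact (\<lambda>x. T x - \<mu> *\<^sub>C x) B K"
        using invertible_modulo_compact_poly[OF T p(2) nz] by blast
      then interpret invertible_modulo_compact "\<lambda>x. T x - \<mu> *\<^sub>C x" B K .
      have surj: "surj (\<lambda>x. T x - \<mu> *\<^sub>C x)"
        by (rule injective_imp_surjective[OF inj])
      have "\<exists>x. y = \<mu> *\<^sub>C x - T x" for y
      proof -
        obtain x where "- y = T x - \<mu> *\<^sub>C x"
          using surjD[OF surj, of "- y"] by blast
        then have "- (- y) = - (T x - \<mu> *\<^sub>C x)"
          by (rule arg_cong)
        then have "y = \<mu> *\<^sub>C x - T x"
          by simp
        then show ?thesis ..
      qed
      moreover obtain c where "c > 0" "\<And>x. c * norm x \<le> norm (T x - \<mu> *\<^sub>C x)"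
        using injective_imp_bounded_below[OF inj] by blast
      ultimately show ?thesis
        by (auto simp: surj_def norm_minus_commute)
    qed
    interpret resolvent_off_finite T E
    proof
      show "finite E"
        using True poly_roots_finite[OF p(1)] by (simp add: E_def)
    qed (use T invertible in auto)
    show ?thesis
    \<comment> \<open>If some \<open>Q n\<close> annihilates \<open>T\<close>, then \<open>T\<close>
      is algebraic. If none does, the resolvent has an essential singularity in \<open>E\<close> for
      suitable \<open>e\<close> and \<open>\<phi>\<close>.\<close>
    proof (cases "\<exists>n. \<forall>x. poly_operator (Q n) T x = 0")
      case True
      then show ?thesis
        using almost_invariant_half_space_of_algebraic[OF assms(1) T Q_nonzero] by metis
    next
      case False
      then show ?thesis
        using almost_invariant_half_space_of_not_algebraic by metis
    qed
  qed
qed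

end
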